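(* Let $\lambda\in\mathbb{R}$ be given and let $\chi_\lambda(x)=2\,\frac{1}{\sqrt{2\pi}}e^{-x^2/2}\int_{-\infty}^{\lambda x}\frac{1}{\sqrt{2\pi}}e^{-t^2/2}\,dt$ be the skew-normal kernel. Let $\Pi^*$ be a Type I or Type II location-scale mixture prior with kernel $\frac1\phi\chi_\lambda\big(\frac{x-\theta}{\phi}\big)$, as defined in the context, satisfying the full support condition (B8) stated there. Let $f_0$ be a continuous density on $\mathbb{R}$ such that (B4) for some $0<M<\infty$, $0<f_0(x)\le M$ for all $x$; (B5) $\left|\int f_0(x)\log f_0(x)\,dx\right|<\infty$; (B6) for some $\delta>0$, $\int f_0(x)\log\frac{f_0(x)}{\phi_\delta(x)}\,dx<\infty$, where $\phi_\delta(x)=\inf_{|t-x|<\delta}f_0(t)$; and there exists $\eta>0$ such that $\int_{\mathbb{R}}|x|^{2(1+\eta)}f_0(x)\,dx<\infty$. Then $f_0\in\mathrm{KL}(\Pi^* )$.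
   Context: $\mathscr{M}(S)$ is the set of probability measures on $S$, $\mathbb{R}^+=(0,\infty)$; a prior is a probability measure on the indicated space; the weak support of a prior on $\mathscr{M}(S)$ is its support in the topology of weak convergence. For a density $\chi$ on $\mathbb{R}$: a Type I location-scale mixture prior $\Pi^*$ is the law of $f_P(x)=\int\frac1\phi\chi\big(\frac{x-\theta}{\phi}\big)dP(\theta,\phi)$ with $P\sim\Pi$, $\Pi$ a prior on $\mathscr{M}(\mathbb{R}\times\mathbb{R}^+)$; condition (B8): the weak support of $\Pi$ is $\mathscr{M}(\mathbb{R}\times\mathbb{R}^+)$. A Type II location-scale mixture prior $\Pi^*$ is the law of $f_{P,\phi}(x)=\int\frac1\phi\chi\big(\frac{x-\theta}{\phi}\big)dP(\theta)$ with independent $P\sim\Pi$ and $\phi\sim\mu$, $\Pi$ a prior on $\mathscr{M}(\mathbb{R})$ and $\mu$ a prior on $(0,\infty)$; condition (B8) then means: the weak support of $\Pi$ is $\mathscr{M}(\mathbb{R})$ and the support of $\mu$ is $(0,\infty)$. $f_0\in\mathrm{KL}(\Pi^* )$ means $\Pi^*(\{f:\int f_0\log(f_0/f)<\epsilon\})>0$ for every $\epsilon>0$. *)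

theory Defs
  imports "HOL-Probability.Probability"
begin

text \<open>\<open>prob_algebra\<close> carries the \<open>\<sigma>\<close>-algebra generated by the evaluations \<open>P \<mapsto> P A\<close>. For the separable
  metrizable \<open>S\<close> used below this is the Borel \<open>\<sigma>\<close>-algebra of the topology of weak convergence.
  A prior on \<open>\<M>(S)\<close> is a member of \<open>space (prob_algebra (prob_measures S))\<close>.\<close>

definition prob_measures :: "'a::topological_space set \<Rightarrow> 'a measure measure" where
  "prob_measures S = prob_algebra (restrict_space borel S)"

definition weak_topology :: "'a::topological_space set \<Rightarrow> 'a measure topology" where
  "weak_topology S = topology_generated_by
     {{P \<in> space (prob_measures S). (\<integral>x. g x \<partial>P) \<in> U} | (g :: 'a \<Rightarrow> real) U.
        continuous_on S g \<and> bounded (g ` S) \<and> open U}"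

definition measure_support :: "'a topology \<Rightarrow> 'a measure \<Rightarrow> 'a set" where
  "measure_support T M = {x \<in> topspace T. \<forall>U. openin T U \<and> x \<in> U \<longrightarrow> emeasure M U > 0}"

definition prob_densities :: "(real \<Rightarrow> real) set" where
  "prob_densities =
     {f \<in> borel_measurable borel. (\<forall>x. 0 \<le> f x) \<and> (\<integral>\<^sup>+x. ennreal (f x) \<partial>lborel) = 1}"

text \<open>The law of \<open>X\<close> as a measure on \<open>\<Omega>\<close>, taken on the largest \<open>\<sigma>\<close>-algebra for which \<open>X\<close> is
  measurable; it extends the law of \<open>X\<close> on every other such \<open>\<sigma>\<close>-algebra.\<close>

definition law :: "'a measure \<Rightarrow> 'b set \<Rightarrow> ('a \<Rightarrow> 'b) \<Rightarrow> 'b measure" where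
  "law M \<Omega> X = distr M (sigma \<Omega> {A. A \<subseteq> \<Omega> \<and> X -` A \<inter> space M \<in> sets M}) X"

definition loc_scale_kernel :: "(real \<Rightarrow> real) \<Rightarrow> real \<Rightarrow> real \<Rightarrow> real \<Rightarrow> real" where
  "loc_scale_kernel k \<theta> \<phi> x = 1 / \<phi> * k ((x - \<theta>) / \<phi>)"

text \<open>The integral defining \<open>mixture_I\<close> may diverge for \<open>x\<close> in a Lebesgue null set, where the
  Bochner integral returns 0.\<close>

definition mixture_I :: "(real \<Rightarrow> real) \<Rightarrow> (real \<times> real) measure \<Rightarrow> real \<Rightarrow> real" where
  "mixture_I k P x = (\<integral>(\<theta>, \<phi>). loc_scale_kernel k \<theta> \<phi> x \<partial>P)"

definition mixture_II :: "(real \<Rightarrow> real) \<Rightarrow> real measure \<Rightarrow> real \<Rightarrow> real \<Rightarrow> real" where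
  "mixture_II k P \<phi> x = (\<integral>\<theta>. loc_scale_kernel k \<theta> \<phi> x \<partial>P)"

definition type_I_prior ::
  "(real \<Rightarrow> real) \<Rightarrow> (real \<times> real) measure measure \<Rightarrow> (real \<Rightarrow> real) measure" where
  "type_I_prior k Q = law Q prob_densities (mixture_I k)"

definition type_II_prior ::
  "(real \<Rightarrow> real) \<Rightarrow> real measure measure \<Rightarrow> real measure \<Rightarrow> (real \<Rightarrow> real) measure" where
  "type_II_prior k Q \<mu> = law (Q \<Otimes>\<^sub>M \<mu>) prob_densities (\<lambda>(P, \<phi>). mixture_II k P \<phi>)"

text \<open>For densities \<open>f0\<close>, \<open>f\<close> the negative part of \<open>f0 log (f0 / f)\<close> is integrable, so the integral
  exists in the extended reals and equals \<open>\<infinity>\<close> whenever the integrand is not integrable. The positivity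
  guard is needed because \<open>ln (f0 x / 0) = 0\<close> in HOL.\<close>

definition KL_dens :: "(real \<Rightarrow> real) \<Rightarrow> (real \<Rightarrow> real) \<Rightarrow> ereal" where
  "KL_dens f0 f =
     (if (AE x in lborel. f0 x > 0 \<longrightarrow> f x > 0) \<and> integrable lborel (\<lambda>x. f0 x * ln (f0 x / f x))
      then ereal (\<integral>x. f0 x * ln (f0 x / f x) \<partial>lborel) else \<infinity>)"

definition KL_support :: "(real \<Rightarrow> real) measure \<Rightarrow> (real \<Rightarrow> real) set" where
  "KL_support Q = {f0 \<in> prob_densities.
     \<forall>\<epsilon>>0. emeasure Q {f \<in> space Q. KL_dens f0 f < ereal \<epsilon>} > 0}"

definition skew_normal :: "real \<Rightarrow> real \<Rightarrow> real" where
  "skew_normal l x = 2 * std_normal_density x * (LBINT t:{..l * x}. std_normal_density t)"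

lemma topspace_weak_topology: "topspace (weak_topology S) = space (prob_measures S)"
proof -
  have "space (prob_measures S) \<in> {{P \<in> space (prob_measures S). (\<integral>x. g x \<partial>P) \<in> U} | (g :: 'a \<Rightarrow> real) U.
        continuous_on S g \<and> bounded (g ` S) \<and> open U}"
    by (rule CollectI, rule exI[of _ "\<lambda>_. 0"], rule exI[of _ UNIV]) (auto intro: bounded_subset[of "{0}"])
  then show ?thesis
    unfolding weak_topology_def topology_generated_by_topspace by blast
qed

lemma emeasure_law:
  assumes X: "X \<in> space M \<rightarrow> \<Omega>" and A: "A \<subseteq> \<Omega>" "X -` A \<inter> space M \<in> sets M"
  shows "emeasure (law M \<Omega> X) A = emeasure M (X -` A \<inter> space M)"
  unfolding law_def
proof (rule emeasure_distr)
  let ?G = "{A. A \<subseteq> \<Omega> \<and> X -` A \<inter> space M \<in> sets M}"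
  show "X \<in> measurable M (sigma \<Omega> ?G)"
    by (rule measurable_measure_of) (use X in auto)
  show "A \<in> sets (sigma \<Omega> ?G)"
    using A by (subst sets_measure_of) auto
qed

end

theory Submission
  imports Defs
begin

text \<open>
  Why the theorem holds. The skew-normal kernel \<open>k\<close> is positive, and \<open>ln k\<close> has a derivative of at most
  linear growth (for the factor \<open>\<Phi>(\<lambda>x)\<close> this is the bound \<open>\<phi>(t) \<le> C (1 + \<bar>t\<bar>) \<Phi>(t)\<close> on the inverse Mills
  ratio). The locale \<open>log_quadratic_kernel\<close> abstracts this property, and the argument takes
  place there. Write \<open>K \<theta> \<phi> x\<close> for the location-scale kernel.

  First, \<open>f0\<close> is approximated in Kullback-Leibler divergence by \<open>g(x) = \<integral>\<^sub>A f0(\<theta>) K \<theta> h x d\<theta>\<close> with \<open>A = [-m, m)\<close>.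
  For \<open>A = \<real>\<close> and \<open>h \<rightarrow> 0\<close> this is dominated convergence: the smoothed density lies between a constant
  times the infimum of \<open>f0\<close> over the \<open>\<delta>\<close>-neighbourhood of \<open>x\<close> and the bound \<open>M\<close> of \<open>f0\<close>, so the
  entropy and local-infimum hypotheses supply the integrable majorant (\<open>smoothed_kl_small\<close>). For fixed \<open>h\<close> and \<open>m \<rightarrow> \<infinity>\<close> the truncated
  integrals increase and are bounded below by \<open>c exp(-A (1 + x\<^sup>2))\<close>, so the second moment supplies it
  (\<open>truncated_kl_small\<close>).

  Second, a weak neighbourhood of mixing measures is found on which the mixture density \<open>f\<close> satisfies
  \<open>f(x) \<ge> exp(-e (2 + x\<^sup>2)) g(x)\<close> for almost all \<open>x\<close>; then the divergence from \<open>f0\<close> to \<open>f\<close> exceeds that of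
  \<open>g\<close> by at most \<open>e \<integral> f0 (2 + x\<^sup>2)\<close>. The growth condition on \<open>ln k\<close> gives the relative perturbation bound
  \<open>K \<theta>' \<phi> x \<ge> exp(-e (1 + x\<^sup>2)) K \<theta> h x\<close>, uniformly in \<open>x \<in> \<real>\<close>, whenever \<open>(\<theta>', \<phi>)\<close> is close to \<open>(\<theta>, h)\<close>
  and \<open>\<theta>\<close> stays bounded (\<open>K_nearby\<close>). This relative bound is valid in the tails as well, so the integral
  does not have to be split into a compact part and a tail. Now \<open>[-m, m)\<close> is cut into finitely many short
  cells, with one hat function \<open>w\<^sub>j\<close> supported in each (for Type I multiplied by a hat
  function of the scale): if \<open>\<integral> w\<^sub>j dP\<close> almost reaches the \<open>f0\<close>-mass of cell \<open>j\<close> for every \<open>j\<close>, the lower bound for \<open>f\<close> follows by summing over the cells (\<open>weighted_lower_bound\<close>,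
  \<open>discretization\<close>, \<open>kl_test_functions\<close>). These conditions define a weakly open set. It is not empty,
  since it contains the image of \<open>f0\<close> under the map that moves each point to the centre of its cell (and
  has scale \<open>h\<close>), so full weak support gives it positive prior probability.

  Third, the divergence is a measurable function of the mixing parameters, so the positive probability
  of the neighbourhood is transported to the law of the mixture density (\<open>KL_law_positive\<close>).
\<close>

section \<open>The skew-normal kernel\<close>

definition std_normal_cdf :: "real \<Rightarrow> real" where
  "std_normal_cdf t = (LBINT s:{..t}. std_normal_density s)"

lemma integrable_std_normal: "integrable lborel std_normal_density"
  by (rule integrable_normal_density) simp

lemma set_integrable_std_normal:
  assumes "A \<in> sets lborel"
  shows "set_integrable lborel A std_normal_density"
  using integrable_mult_indicator[OF assms integrable_std_normal] by (simp add: set_integrable_def)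

lemma std_normal_cdf_DERIV: "(std_normal_cdf has_real_derivative std_normal_density t) (at t)"
proof -
  let ?a = "t - 1" and ?b = "t + 1"
  have cont: "continuous_on {?a..?b} std_normal_density"
    unfolding normal_density_def by (auto intro!: continuous_intros)
  have eq: "std_normal_cdf x = std_normal_cdf ?a + integral {?a..x} std_normal_density" if "?a \<le> x" for x
  proof -
    have "{..x} = {..?a} \<union> {?a<..x}" using that by auto
    then have "std_normal_cdf x = std_normal_cdf ?a + (LBINT s:{?a<..x}. std_normal_density s)"
      unfolding std_normal_cdf_def
      by (simp add: set_integral_Un set_integrable_std_normal disjoint_iff)
    also have "(LBINT s:{?a<..x}. std_normal_density s) = integral {?a<..x} std_normal_density"
      by (intro set_borel_integral_eq_integral set_integrable_std_normal) auto
    also have "\<dots> = integral {?a..x} std_normal_density"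
      by (intro integral_spike_set negligible_subset[OF negligible_sing[of ?a]]) auto
    finally show ?thesis .
  qed
  have "((\<lambda>x. integral {?a..x} std_normal_density) has_real_derivative std_normal_density t)
      (at t within {?a..?b})"
    by (rule integral_has_real_derivative[OF cont]) auto
  then have "((\<lambda>x. integral {?a..x} std_normal_density) has_real_derivative std_normal_density t) (at t)"
    by (subst (asm) at_within_Icc_at) auto
  from DERIV_add[OF DERIV_const this]
  have "((\<lambda>x. std_normal_cdf ?a + integral {?a..x} std_normal_density)
      has_real_derivative std_normal_density t) (at t)"
    by simp
  then show ?thesis
    by (rule has_field_derivative_transform_within_open[of _ _ _ "{?a<..<?b}"])
      (auto intro!: eq[symmetric])
qed

lemma std_normal_cdf_nonneg: "0 \<le> std_normal_cdf t"
  unfolding std_normal_cdf_def set_lebesgue_integral_def by (rule Bochner_Integration.integral_nonneg) simp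

text \<open>
  The density varies by at most the factor \<open>exp (3/2)\<close> on the interval of length \<open>1 / (1 + \<bar>t\<bar>)\<close> to the
  left of \<open>t\<close>, and the distribution function dominates the integral over this interval.
\<close>

lemma std_normal_mills: "std_normal_density t \<le> exp (3/2) * (1 + \<bar>t\<bar>) * std_normal_cdf t"
proof -
  define a where "a = 1 / (1 + \<bar>t\<bar>)"
  have a: "0 < a" "a \<le> 1" "a * (1 + \<bar>t\<bar>) = 1" by (auto simp: a_def field_simps)
  have low: "exp (- (3/2)) * std_normal_density t \<le> std_normal_density s" if "s \<in> {t - a..t}" for s
  proof -
    have "s\<^sup>2 - t\<^sup>2 = (s - t) * (s + t)" by (simp add: power2_eq_square algebra_simps)
    also have "\<dots> \<le> \<bar>s - t\<bar> * \<bar>s + t\<bar>" by (simp flip: abs_mult)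
    also have "\<dots> \<le> a * (2 * \<bar>t\<bar> + 1)" using that a by (intro mult_mono) auto
    also have "\<dots> \<le> 3" using a by (simp add: algebra_simps)
    finally have "- (3/2) - t\<^sup>2 / 2 \<le> - (s\<^sup>2 / 2)" by simp
    then have "exp (- (3/2)) * exp (- (t\<^sup>2 / 2)) \<le> exp (- (s\<^sup>2 / 2))"
      by (simp flip: exp_add)
    then show ?thesis
      by (simp add: std_normal_density_def divide_right_mono field_simps)
  qed
  have "a * (exp (- (3/2)) * std_normal_density t)
      = (LBINT s. indicator {t - a..t} s * (exp (- (3/2)) * std_normal_density t))"
    using a by (simp add: measure_lborel_Icc)
  also have "\<dots> \<le> std_normal_cdf t"
    unfolding std_normal_cdf_def set_lebesgue_integral_def
  proof (rule integral_mono)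
    show "integrable lborel (\<lambda>s. indicator {..t} s *\<^sub>R std_normal_density s)"
      using set_integrable_std_normal[of "{..t}"] by (simp add: set_integrable_def)
    show "indicator {t - a..t} s * (exp (- (3/2)) * std_normal_density t)
        \<le> indicator {..t} s *\<^sub>R std_normal_density s" for s
      using low[of s] by (auto simp: indicator_def simp del: normal_density_def)
  qed (use a in auto)
  finally have "a * (exp (- (3/2)) * std_normal_density t) * (exp (3/2) * (1 + \<bar>t\<bar>))
      \<le> std_normal_cdf t * (exp (3/2) * (1 + \<bar>t\<bar>))" by (intro mult_right_mono) auto
  moreover have "a * (exp (- (3/2)) * std_normal_density t) * (exp (3/2) * (1 + \<bar>t\<bar>))
    = (a * (1 + \<bar>t\<bar>)) * (exp (- (3/2)) * exp (3/2)) * std_normal_density t" by (simp only: ac_simps)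
  moreover have "exp (- (3/2)) * exp (3/2 :: real) = 1" by (simp flip: exp_add)
  ultimately show ?thesis using a(3) by (simp only: mult_1_left mult.commute)
qed

lemma std_normal_cdf_pos: "0 < std_normal_cdf t"
proof (rule ccontr)
  assume "\<not> 0 < std_normal_cdf t"
  then have "std_normal_cdf t = 0" using std_normal_cdf_nonneg[of t] by simp
  then show False using std_normal_mills[of t] normal_density_pos[of 1 0 t] by simp
qed

text \<open>
  By the mean value theorem, since the derivative of \<open>ln \<Phi>\<close> is the ratio bounded in
  \<open>std_normal_mills\<close>.
\<close>

lemma ln_std_normal_cdf_bound:
  "\<bar>ln (std_normal_cdf s) - ln (std_normal_cdf t)\<bar> \<le> exp (3/2) * (1 + \<bar>s\<bar> + \<bar>t\<bar>) * \<bar>s - t\<bar>"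
proof -
  have ordered: "\<bar>ln (std_normal_cdf s) - ln (std_normal_cdf t)\<bar>
      \<le> exp (3/2) * (1 + \<bar>s\<bar> + \<bar>t\<bar>) * \<bar>s - t\<bar>" if "s < t" for s t
  proof -
    have "((\<lambda>z. ln (std_normal_cdf z)) has_real_derivative
        std_normal_density z / std_normal_cdf z) (at z)" for z
      using DERIV_chain2[OF DERIV_ln_divide[OF std_normal_cdf_pos] std_normal_cdf_DERIV] by simp
    from MVT2[OF that this] obtain z where z: "s < z" "z < t"
      "ln (std_normal_cdf t) - ln (std_normal_cdf s) = (t - s) * (std_normal_density z / std_normal_cdf z)"
      by auto
    have "std_normal_density z / std_normal_cdf z \<le> exp (3/2) * (1 + \<bar>z\<bar>)"
      unfolding pos_divide_le_eq[OF std_normal_cdf_pos] by (rule std_normal_mills)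
    also have "\<dots> \<le> exp (3/2) * (1 + \<bar>s\<bar> + \<bar>t\<bar>)" using z by (intro mult_left_mono) auto
    finally have up: "std_normal_density z / std_normal_cdf z \<le> exp (3/2) * (1 + \<bar>s\<bar> + \<bar>t\<bar>)" .
    have nn: "0 \<le> (t - s) * (std_normal_density z / std_normal_cdf z)"
      by (rule mult_nonneg_nonneg[OF _ divide_nonneg_pos[OF normal_density_nonneg std_normal_cdf_pos]])
        (use that in simp)
    have "\<bar>ln (std_normal_cdf s) - ln (std_normal_cdf t)\<bar> = \<bar>ln (std_normal_cdf t) - ln (std_normal_cdf s)\<bar>"
      by (rule abs_minus_commute)
    also have "\<dots> = (t - s) * (std_normal_density z / std_normal_cdf z)"
      unfolding z(3) by (rule abs_of_nonneg[OF nn])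
    also have "\<dots> \<le> (t - s) * (exp (3/2) * (1 + \<bar>s\<bar> + \<bar>t\<bar>))"
      using up that by (intro mult_left_mono) auto
    also have "\<dots> = exp (3/2) * (1 + \<bar>s\<bar> + \<bar>t\<bar>) * \<bar>s - t\<bar>"
      using that by (simp only: mult.commute[of "t - s"] abs_of_neg[of "s - t"] diff_less_0_iff_less minus_diff_eq)
    finally show ?thesis .
  qed
  consider "s < t" | "s = t" | "t < s" by linarith
  then show ?thesis
  proof cases
    case 1
    then show ?thesis by (rule ordered)
  next
    case 2
    then show ?thesis by simp
  next
    case 3
    have "\<bar>ln (std_normal_cdf s) - ln (std_normal_cdf t)\<bar> = \<bar>ln (std_normal_cdf t) - ln (std_normal_cdf s)\<bar>"
      by (rule abs_minus_commute)
    also have "\<dots> \<le> exp (3/2) * (1 + \<bar>t\<bar> + \<bar>s\<bar>) * \<bar>t - s\<bar>"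
      by (rule ordered[OF 3])
    also have "\<dots> = exp (3/2) * (1 + \<bar>s\<bar> + \<bar>t\<bar>) * \<bar>s - t\<bar>"
      by (simp only: abs_minus_commute[of t s] add.assoc add.commute[of "\<bar>t\<bar>"])
    finally show ?thesis .
  qed
qed

lemma std_normal_cdf_minus: "std_normal_cdf t + std_normal_cdf (- t) = 1"
proof -
  have "std_normal_cdf (- t) = (LBINT s. indicator {..- t} s *\<^sub>R std_normal_density s)"
    by (simp add: std_normal_cdf_def set_lebesgue_integral_def)
  also have "\<dots> = (LBINT s. indicator {..- t} (- s) *\<^sub>R std_normal_density (- s))"
    using lborel_integral_real_affine[of "-1" "\<lambda>s. indicator {..- t} s *\<^sub>R std_normal_density s" 0]
    by simp
  also have "\<dots> = (LBINT s:{t..}. std_normal_density s)"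
    unfolding set_lebesgue_integral_def
    by (intro Bochner_Integration.integral_cong) (auto simp: indicator_def std_normal_density_def)
  also have "\<dots> = (LBINT s:{t<..}. std_normal_density s)"
    unfolding set_lebesgue_integral_def
  proof (rule integral_cong_AE)
    show "AE s in lborel. indicator {t..} s *\<^sub>R std_normal_density s
        = indicator {t<..} s *\<^sub>R std_normal_density s"
      using AE_lborel_singleton[of t] by eventually_elim (simp add: indicator_def)
  qed simp_all
  finally have "std_normal_cdf t + std_normal_cdf (- t)
      = (LBINT s:{..t} \<union> {t<..}. std_normal_density s)"
    unfolding std_normal_cdf_def
    by (subst set_integral_Un) (auto intro: set_integrable_std_normal simp: disjoint_iff)
  also have "{..t} \<union> {t<..} = UNIV" by auto
  also have "(LBINT s:UNIV. std_normal_density s) = 1"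
    by (simp add: set_lebesgue_integral_def integral_normal_density)
  finally show ?thesis .
qed

lemma std_normal_cdf_measurable [measurable]: "std_normal_cdf \<in> borel_measurable borel"
proof (rule borel_measurable_continuous_onI)
  show "continuous_on UNIV std_normal_cdf"
    by (intro continuous_at_imp_continuous_on ballI DERIV_isCont[OF std_normal_cdf_DERIV])
qed

lemma skew_normal_eq: "skew_normal l x = 2 * std_normal_density x * std_normal_cdf (l * x)"
  unfolding skew_normal_def std_normal_cdf_def ..

lemma skew_normal_pos: "0 < skew_normal l x"
  using std_normal_cdf_pos[of "l * x"] normal_density_pos[of 1 0 x] by (simp only: skew_normal_eq zero_less_mult_iff) simp

lemma skew_normal_measurable [measurable]: "skew_normal l \<in> borel_measurable borel"
proof -
  have "(\<lambda>x. 2 * std_normal_density x * std_normal_cdf (l * x)) \<in> borel_measurable borel"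
    by measurable
  moreover have "skew_normal l = (\<lambda>x. 2 * std_normal_density x * std_normal_cdf (l * x))"
    by (intro ext skew_normal_eq)
  ultimately show ?thesis by simp
qed

text \<open>
  Reflection turns the factor \<open>\<Phi>(\<lambda>x)\<close> into \<open>\<Phi>(-\<lambda>x)\<close>, and the two add up to 1; so twice the integral is
  twice the total mass of the normal density.
\<close>

lemma skew_normal_total: "(\<integral>\<^sup>+x. ennreal (skew_normal l x) \<partial>lborel) = 1"
proof -
  let ?I = "\<integral>\<^sup>+x. ennreal (skew_normal l x) \<partial>lborel"
  have "?I = (\<integral>\<^sup>+x. ennreal (skew_normal l (- x)) \<partial>lborel)"
    using nn_integral_real_affine[of "\<lambda>x. ennreal (skew_normal l x)" "-1" 0] by simp
  then have "?I + ?I = (\<integral>\<^sup>+x. ennreal (skew_normal l x) \<partial>lborel) + (\<integral>\<^sup>+x. ennreal (skew_normal l (- x)) \<partial>lborel)"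
    by simp
  also have "\<dots> = (\<integral>\<^sup>+x. ennreal (skew_normal l x) + ennreal (skew_normal l (- x)) \<partial>lborel)"
    by (rule nn_integral_add[symmetric]) auto
  also have "\<dots> = (\<integral>\<^sup>+x. ennreal 2 * ennreal (std_normal_density x) \<partial>lborel)"
  proof (rule nn_integral_cong)
    fix x
    have "skew_normal l x + skew_normal l (- x)
        = 2 * std_normal_density x * (std_normal_cdf (l * x) + std_normal_cdf (- (l * x)))"
      by (simp add: skew_normal_eq std_normal_density_def distrib_left)
    also have "\<dots> = 2 * std_normal_density x" by (simp only: std_normal_cdf_minus mult_1_right)
    finally show "ennreal (skew_normal l x) + ennreal (skew_normal l (- x))
        = ennreal 2 * ennreal (std_normal_density x)"
      by (subst ennreal_plus[symmetric])
        (auto simp: less_imp_le[OF skew_normal_pos] ennreal_mult)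
  qed
  also have "\<dots> = ennreal 2 * (\<integral>\<^sup>+x. ennreal (std_normal_density x) \<partial>lborel)"
    by (rule nn_integral_cmult) auto
  also have "(\<integral>\<^sup>+x. ennreal (std_normal_density x) \<partial>lborel) = 1"
    by (subst nn_integral_eq_integral) (auto simp: integrable_std_normal integral_normal_density)
  finally have two: "?I + ?I = 2" by simp
  have "?I \<noteq> \<top>"
  proof
    assume "?I = \<top>"
    with two show False by simp
  qed
  then obtain r where r: "?I = ennreal r" "0 \<le> r" by (cases ?I) auto
  have "ennreal r + ennreal r = 2" using two by (simp only: r)
  then have "ennreal (r + r) = ennreal 2" using r by (simp only: ennreal_plus ennreal_numeral)
  then have "r = 1" using r by (subst (asm) ennreal_inj) auto
  then show ?thesis using r by simp
qed

lemma ln_skew_normal_bound: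
  "\<bar>ln (skew_normal l u) - ln (skew_normal l v)\<bar>
    \<le> (1 + exp (3/2) * \<bar>l\<bar> * (1 + \<bar>l\<bar>)) * (1 + \<bar>u\<bar> + \<bar>v\<bar>) * \<bar>u - v\<bar>"
proof -
  have ln_eq: "ln (skew_normal l x) = ln 2 - ln (sqrt (2 * pi)) - x\<^sup>2 / 2 + ln (std_normal_cdf (l * x))" for x
    using std_normal_cdf_pos[of "l * x"]
    by (simp add: skew_normal_eq std_normal_density_def ln_mult_pos ln_div)
  have sq: "\<bar>v\<^sup>2 / 2 - u\<^sup>2 / 2\<bar> \<le> (1 + \<bar>u\<bar> + \<bar>v\<bar>) * \<bar>u - v\<bar>"
  proof -
    have "v\<^sup>2 / 2 - u\<^sup>2 / 2 = - ((u + v) / 2 * (u - v))"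
      by (simp add: power2_eq_square field_simps)
    then have "\<bar>v\<^sup>2 / 2 - u\<^sup>2 / 2\<bar> = \<bar>u + v\<bar> / 2 * \<bar>u - v\<bar>"
      by (simp only: abs_minus_cancel abs_mult abs_divide abs_numeral)
    also have "\<dots> \<le> (1 + \<bar>u\<bar> + \<bar>v\<bar>) * \<bar>u - v\<bar>" by (intro mult_right_mono) auto
    finally show ?thesis .
  qed
  have "\<bar>ln (std_normal_cdf (l * u)) - ln (std_normal_cdf (l * v))\<bar>
      \<le> exp (3/2) * (1 + \<bar>l * u\<bar> + \<bar>l * v\<bar>) * \<bar>l * u - l * v\<bar>"
    by (rule ln_std_normal_cdf_bound)
  also have "\<bar>l * u - l * v\<bar> = \<bar>l\<bar> * \<bar>u - v\<bar>"
    by (simp only: abs_mult right_diff_distrib[symmetric])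
  also have "exp (3/2) * (1 + \<bar>l * u\<bar> + \<bar>l * v\<bar>) * (\<bar>l\<bar> * \<bar>u - v\<bar>)
      = exp (3/2) * \<bar>l\<bar> * (1 + \<bar>l\<bar> * \<bar>u\<bar> + \<bar>l\<bar> * \<bar>v\<bar>) * \<bar>u - v\<bar>"
    by (simp only: abs_mult ac_simps)
  also have "\<dots> \<le> exp (3/2) * \<bar>l\<bar> * ((1 + \<bar>l\<bar>) * (1 + \<bar>u\<bar> + \<bar>v\<bar>)) * \<bar>u - v\<bar>"
    by (intro mult_right_mono mult_left_mono) (auto simp: algebra_simps)
  finally have cdf: "\<bar>ln (std_normal_cdf (l * u)) - ln (std_normal_cdf (l * v))\<bar>
      \<le> exp (3/2) * \<bar>l\<bar> * (1 + \<bar>l\<bar>) * ((1 + \<bar>u\<bar> + \<bar>v\<bar>) * \<bar>u - v\<bar>)" by (simp only: mult.assoc)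
  have "ln (skew_normal l u) - ln (skew_normal l v)
      = (v\<^sup>2 / 2 - u\<^sup>2 / 2) + (ln (std_normal_cdf (l * u)) - ln (std_normal_cdf (l * v)))"
    by (simp only: ln_eq)
  also have "\<bar>\<dots>\<bar> \<le> (1 + \<bar>u\<bar> + \<bar>v\<bar>) * \<bar>u - v\<bar>
      + exp (3/2) * \<bar>l\<bar> * (1 + \<bar>l\<bar>) * ((1 + \<bar>u\<bar> + \<bar>v\<bar>) * \<bar>u - v\<bar>)"
    by (rule order_trans[OF abs_triangle_ineq add_mono[OF sq cdf]])
  also have "\<dots> = (1 + exp (3/2) * \<bar>l\<bar> * (1 + \<bar>l\<bar>)) * (1 + \<bar>u\<bar> + \<bar>v\<bar>) * \<bar>u - v\<bar>"
    by (simp only: distrib_right mult.assoc mult_1_left add.assoc)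
  finally show ?thesis .
qed

section \<open>Kernels whose logarithm varies at most quadratically\<close>

lemma square_add_abs_le:
  fixes r x :: real
  assumes "1 \<le> r"
  shows "(r + \<bar>x\<bar>)\<^sup>2 \<le> 2 * r\<^sup>2 * (1 + x\<^sup>2)"
proof -
  have "1 * \<bar>x\<bar> \<le> r * \<bar>x\<bar>" using assms by (intro mult_right_mono) auto
  then have "(r + \<bar>x\<bar>)\<^sup>2 \<le> (r * (1 + \<bar>x\<bar>))\<^sup>2"
    using assms by (intro power_mono) (auto simp: distrib_left)
  also have "\<dots> = r\<^sup>2 * (1 + \<bar>x\<bar>)\<^sup>2" by (rule power_mult_distrib)
  also have "\<dots> \<le> r\<^sup>2 * (2 * (1 + x\<^sup>2))"
  proof (rule mult_left_mono)
    show "(1 + \<bar>x\<bar>)\<^sup>2 \<le> 2 * (1 + x\<^sup>2)"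
      using sum_squares_bound[of 1 "\<bar>x\<bar>"] by (simp add: power2_sum)
  qed simp
  finally show ?thesis by (simp only: ac_simps)
qed

text \<open>
  The last condition is the integrated form of a linear growth bound on the derivative of \<open>ln k\<close>. The
  Gaussian satisfies it, and so does every positive density whose logarithm has a bounded second
  derivative.
\<close>

locale log_quadratic_kernel =
  fixes k :: "real \<Rightarrow> real" and C :: real
  assumes k_measurable [measurable]: "k \<in> borel_measurable borel"
    and k_pos: "0 < k u"
    and k_total: "(\<integral>\<^sup>+u. ennreal (k u) \<partial>lborel) = 1"
    and ln_k_bound: "\<bar>ln (k u) - ln (k v)\<bar> \<le> C * (1 + \<bar>u\<bar> + \<bar>v\<bar>) * \<bar>u - v\<bar>"
begin

abbreviation K :: "real \<Rightarrow> real \<Rightarrow> real \<Rightarrow> real" where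
  "K \<equiv> loc_scale_kernel k"

lemma C_nonneg: "0 \<le> C"
proof -
  have "0 \<le> \<bar>ln (k 1) - ln (k 0)\<bar>" by simp
  also have "\<dots> \<le> C * 2" using ln_k_bound[of 1 0] by simp
  finally show ?thesis by simp
qed

lemma K_pos: "0 < \<phi> \<Longrightarrow> 0 < K \<theta> \<phi> x"
  using k_pos by (simp add: loc_scale_kernel_def)

lemma ln_K: "0 < \<phi> \<Longrightarrow> ln (K \<theta> \<phi> x) = ln (k ((x - \<theta>) / \<phi>)) - ln \<phi>"
  using k_pos[of "(x - \<theta>) / \<phi>"] by (simp add: loc_scale_kernel_def ln_div)

lemma measurable_K [measurable (raw)]:
  assumes [measurable]: "f \<in> borel_measurable M" "g \<in> borel_measurable M" "h \<in> borel_measurable M"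
  shows "(\<lambda>z. K (f z) (g z) (h z)) \<in> borel_measurable M"
  unfolding loc_scale_kernel_def by measurable

lemma integrable_k: "integrable lborel k"
  using k_total k_pos[THEN less_imp_le] by (intro integrableI_nonneg) auto

lemma integral_k: "(\<integral>u. k u \<partial>lborel) = 1"
  using k_total k_pos[THEN less_imp_le] by (simp add: integral_eq_nn_integral)

lemma nn_integral_K:
  assumes "0 < \<phi>"
  shows "(\<integral>\<^sup>+x. ennreal (K \<theta> \<phi> x) \<partial>lborel) = 1"
proof -
  have "(\<integral>\<^sup>+x. ennreal (K \<theta> \<phi> x) \<partial>lborel)
      = ennreal \<phi> * (\<integral>\<^sup>+u. ennreal (K \<theta> \<phi> (\<theta> + \<phi> * u)) \<partial>lborel)"
    using nn_integral_real_affine[of "\<lambda>x. ennreal (K \<theta> \<phi> x)" \<phi> \<theta>] assms by simp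
  also have "\<dots> = (\<integral>\<^sup>+u. ennreal \<phi> * ennreal (K \<theta> \<phi> (\<theta> + \<phi> * u)) \<partial>lborel)"
    by (rule nn_integral_cmult[symmetric]) measurable
  also have "\<dots> = (\<integral>\<^sup>+u. ennreal (k u) \<partial>lborel)"
    using assms k_pos[THEN less_imp_le]
    by (intro nn_integral_cong) (simp add: loc_scale_kernel_def flip: ennreal_mult)
  finally show ?thesis by (simp add: k_total)
qed

lemma K_substitution:
  assumes "0 < h"
  shows "(\<integral>\<theta>. f \<theta> * K \<theta> h x \<partial>lborel) = (\<integral>u. f (x - h * u) * k u \<partial>lborel)"
proof -
  have "(\<integral>\<theta>. f \<theta> * K \<theta> h x \<partial>lborel) = \<bar>- h\<bar> *\<^sub>R (\<integral>u. f (x + (- h) * u) * K (x + (- h) * u) h x \<partial>lborel)"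
    by (rule lborel_integral_real_affine) (use assms in simp)
  also have "\<dots> = (\<integral>u. h * (f (x - h * u) * K (x - h * u) h x) \<partial>lborel)"
    using assms by simp
  also have "\<dots> = (\<integral>u. f (x - h * u) * k u \<partial>lborel)"
    using assms by (intro Bochner_Integration.integral_cong) (auto simp: loc_scale_kernel_def)
  finally show ?thesis .
qed

lemma integrable_K_substitution:
  assumes "0 < h" "integrable lborel (\<lambda>u. f (x - h * u) * k u)"
  shows "integrable lborel (\<lambda>\<theta>. f \<theta> * K \<theta> h x)"
proof -
  have "integrable lborel (\<lambda>u. f (x + (- h) * u) * K (x + (- h) * u) h x)"
    using assms(1) integrable_mult_right[OF assms(2), of "1 / h"]
    by (simp add: loc_scale_kernel_def mult.commute)
  then show ?thesis
    using assms(1) lborel_integrable_real_affine_iff[of "- h" "\<lambda>\<theta>. f \<theta> * K \<theta> h x" x] by simp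
qed

text \<open>
  Comparison of \<open>ln k\<close> at \<open>(x - \<theta>) / h\<close> with \<open>ln k\<close> at 0.
\<close>

lemma K_lower_bound:
  assumes h: "0 < h" and R: "0 \<le> R"
  obtains A where "\<And>\<theta> x. \<bar>\<theta>\<bar> \<le> R \<Longrightarrow> exp (- (A * (1 + x\<^sup>2))) \<le> K \<theta> h x"
proof -
  define B where "B = C * (1 + 1 / h)\<^sup>2 * (2 * (1 + R)\<^sup>2)"
  define A where "A = B + \<bar>ln (k 0)\<bar> + \<bar>ln h\<bar>"
  have "exp (- (A * (1 + x\<^sup>2))) \<le> K \<theta> h x" if t: "\<bar>\<theta>\<bar> \<le> R" for \<theta> x
  proof -
    let ?u = "(x - \<theta>) / h"
    have "\<bar>x - \<theta>\<bar> \<le> \<bar>x\<bar> + R" using t by linarith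
    then have u: "\<bar>?u\<bar> \<le> (\<bar>x\<bar> + R) / h" using h by (simp add: divide_right_mono)
    also have "\<dots> \<le> (1 + 1 / h) * (1 + R + \<bar>x\<bar>)"
    proof -
      have "(\<bar>x\<bar> + R) / h \<le> (1 / h) * (1 + R + \<bar>x\<bar>)" using h by (simp add: divide_right_mono)
      also have "\<dots> \<le> (1 + 1 / h) * (1 + R + \<bar>x\<bar>)" using R by (intro mult_right_mono) auto
      finally show ?thesis .
    qed
    finally have u1: "\<bar>?u\<bar> \<le> (1 + 1 / h) * (1 + R + \<bar>x\<bar>)" .
    have u2: "1 + \<bar>?u\<bar> \<le> (1 + 1 / h) * (1 + R + \<bar>x\<bar>)"
    proof -
      have "1 + (\<bar>x\<bar> + R) / h \<le> (1 + R + \<bar>x\<bar>) + (1 / h) * (1 + R + \<bar>x\<bar>)"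
        using h R by (intro add_mono) (auto simp: divide_right_mono)
      then show ?thesis using u by (simp add: distrib_right)
    qed
    have sq: "(1 + R + \<bar>x\<bar>)\<^sup>2 \<le> 2 * (1 + R)\<^sup>2 * (1 + x\<^sup>2)"
      using R by (intro square_add_abs_le) simp
    have "\<bar>ln (k ?u) - ln (k 0)\<bar> \<le> C * ((1 + \<bar>?u\<bar>) * \<bar>?u\<bar>)"
      using ln_k_bound[of ?u 0] by (simp add: mult.assoc)
    also have "\<dots> \<le> C * (((1 + 1 / h) * (1 + R + \<bar>x\<bar>)) * ((1 + 1 / h) * (1 + R + \<bar>x\<bar>)))"
      using C_nonneg h R by (intro mult_left_mono mult_mono u1 u2) auto
    also have "\<dots> = C * (1 + 1 / h)\<^sup>2 * (1 + R + \<bar>x\<bar>)\<^sup>2"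
      by (simp only: power2_eq_square ac_simps)
    also have "\<dots> \<le> C * (1 + 1 / h)\<^sup>2 * (2 * (1 + R)\<^sup>2 * (1 + x\<^sup>2))"
      using C_nonneg by (intro mult_left_mono sq) auto
    also have "\<dots> = B * (1 + x\<^sup>2)" by (simp only: B_def mult.assoc)
    finally have d: "\<bar>ln (k ?u) - ln (k 0)\<bar> \<le> B * (1 + x\<^sup>2)" .
    have "(\<bar>ln (k 0)\<bar> + \<bar>ln h\<bar>) * 1 \<le> (\<bar>ln (k 0)\<bar> + \<bar>ln h\<bar>) * (1 + x\<^sup>2)"
      by (intro mult_left_mono) auto
    moreover have "A * (1 + x\<^sup>2) = B * (1 + x\<^sup>2) + (\<bar>ln (k 0)\<bar> + \<bar>ln h\<bar>) * (1 + x\<^sup>2)"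
      by (simp only: A_def distrib_right add.assoc)
    moreover have "- (n + m) \<le> a - c" if "\<bar>a - b\<bar> \<le> n" "\<bar>b\<bar> + \<bar>c\<bar> \<le> m" for a b c n m :: real
      using that by linarith
    ultimately have "- (A * (1 + x\<^sup>2)) \<le> ln (K \<theta> h x)"
      using d unfolding ln_K[OF h] by simp
    then have "exp (- (A * (1 + x\<^sup>2))) \<le> exp (ln (K \<theta> h x))" by simp
    then show ?thesis using K_pos[OF h] by simp
  qed
  then show ?thesis by (rule that)
qed

text \<open>
  The arguments \<open>(x - \<theta>) / h\<close> and \<open>(x - \<theta>') / \<phi>\<close> of \<open>k\<close> differ by \<open>O(d (1 + \<bar>x\<bar>))\<close> and are themselves
  \<open>O(1 + \<bar>x\<bar>)\<close>, so \<open>ln k\<close> changes by \<open>O(d (1 + x\<^sup>2))\<close>. The bound is relative and holds for all real \<open>x\<close>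
  at once, which is what makes it summable over a mixture and integrable against a density with second
  moment.
\<close>

lemma K_nearby:
  assumes h: "0 < h" and R: "0 \<le> R" and e: "0 < e"
  obtains d where "0 < d" "d < h"
    "\<And>\<theta> \<theta>' \<phi> x. \<bar>\<theta>\<bar> \<le> R \<Longrightarrow> \<bar>\<theta>' - \<theta>\<bar> \<le> d \<Longrightarrow> \<bar>\<phi> - h\<bar> \<le> d
      \<Longrightarrow> exp (- (e * (1 + x\<^sup>2))) * K \<theta> h x \<le> K \<theta>' \<phi> x"
proof -
  \<comment> \<open>The difference of the arguments of \<open>k\<close> is at most \<open>y d a\<close>, and 1 plus their absolute values is at most \<open>y b\<close>, where \<open>y = 2 + R + \<bar>x\<bar>\<close>.\<close>
  define a where "a = 2 / h * (1 / h) + 2 / h"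
  define b where "b = 1 + 3 / h"
  define A where "A = C * b * a * (2 * (2 + R)\<^sup>2) + 1 / h"
  define d where "d = min (min 1 (h / 2)) (e / A)"
  have pos: "0 < a" "0 < b" using h by (auto simp: a_def b_def intro!: add_pos_pos)
  have A: "0 < A" unfolding A_def using C_nonneg pos h by (intro add_nonneg_pos mult_nonneg_nonneg) auto
  have d: "0 < d" "d \<le> 1" "d \<le> h / 2" "d * A \<le> e"
  proof -
    show "0 < d" "d \<le> 1" using h e A by (auto simp: d_def min_le_iff_disj)
    show "d \<le> h / 2" unfolding d_def by (rule min.coboundedI1[OF min.cobounded2])
    have "d * A \<le> e / A * A" using A by (intro mult_right_mono) (auto simp: d_def)
    then show "d * A \<le> e" using A by simp
  qed
  have "exp (- (e * (1 + x\<^sup>2))) * K \<theta> h x \<le> K \<theta>' \<phi> x"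
    if t: "\<bar>\<theta>\<bar> \<le> R" "\<bar>\<theta>' - \<theta>\<bar> \<le> d" "\<bar>\<phi> - h\<bar> \<le> d" for \<theta> \<theta>' \<phi> x
  proof -
    let ?u = "(x - \<theta>) / h" and ?v = "(x - \<theta>') / \<phi>"
    define y where "y = 2 + R + \<bar>x\<bar>"
    have phi: "h / 2 \<le> \<phi>" "0 < \<phi>" using t d h by (auto simp: abs_le_iff)
    have y: "1 \<le> y" "\<bar>x - \<theta>\<bar> \<le> y" "\<bar>x - \<theta>'\<bar> \<le> y" using t d R by (auto simp: y_def)
    have inv: "1 / \<phi> \<le> 2 / h" using phi h by (simp add: field_simps)
    have u: "\<bar>?u\<bar> \<le> y * (1 / h)" using y h by (simp add: divide_right_mono)
    have "\<bar>?v\<bar> = \<bar>x - \<theta>'\<bar> * (1 / \<phi>)" using phi by simp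
    also have "\<dots> \<le> y * (2 / h)" using y inv phi by (intro mult_mono) auto
    finally have v: "\<bar>?v\<bar> \<le> y * (2 / h)" .
    have "1 + \<bar>?u\<bar> + \<bar>?v\<bar> \<le> y * 1 + y * (1 / h) + y * (2 / h)" using u v y by simp
    also have "\<dots> = y * b" by (simp add: b_def distrib_left)
    finally have uv: "1 + \<bar>?u\<bar> + \<bar>?v\<bar> \<le> y * b" .
    have "?u - ?v = (x - \<theta>) * (\<phi> - h) * (1 / \<phi> * (1 / h)) + (\<theta>' - \<theta>) * (1 / \<phi>)"
      using phi h by (simp add: field_simps)
    also have "\<bar>\<dots>\<bar> \<le> \<bar>x - \<theta>\<bar> * \<bar>\<phi> - h\<bar> * (1 / \<phi> * (1 / h)) + \<bar>\<theta>' - \<theta>\<bar> * (1 / \<phi>)"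
      using phi h by (intro order_trans[OF abs_triangle_ineq]) (simp add: abs_mult)
    also have "\<dots> \<le> y * d * (2 / h * (1 / h)) + d * (2 / h)"
      using y t inv phi h d by (intro add_mono mult_mono) auto
    also have "\<dots> \<le> y * d * (2 / h * (1 / h)) + y * d * (2 / h)"
      using y d h by (intro add_left_mono mult_right_mono) auto
    finally have diff0: "\<bar>?u - ?v\<bar> \<le> y * d * (2 / h * (1 / h)) + y * d * (2 / h)" .
    have diff: "\<bar>?u - ?v\<bar> \<le> y * (d * a)"
      using diff0 by (simp only: a_def distrib_left mult.assoc)
    have "\<bar>ln (k ?u) - ln (k ?v)\<bar> \<le> C * ((1 + \<bar>?u\<bar> + \<bar>?v\<bar>) * \<bar>?u - ?v\<bar>)"
      using ln_k_bound[of ?u ?v] by (simp only: mult.assoc)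
    also have "\<dots> \<le> C * ((y * b) * (y * (d * a)))"
      using C_nonneg y d pos by (intro mult_left_mono mult_mono uv diff) auto
    also have "\<dots> = d * (C * b * a) * y\<^sup>2" by (simp only: power2_eq_square ac_simps)
    also have "\<dots> \<le> d * (C * b * a) * (2 * (2 + R)\<^sup>2 * (1 + x\<^sup>2))"
      unfolding y_def using C_nonneg d pos R by (intro mult_left_mono square_add_abs_le) auto
    finally have lnk: "\<bar>ln (k ?u) - ln (k ?v)\<bar> \<le> d * (C * b * a) * (2 * (2 + R)\<^sup>2 * (1 + x\<^sup>2))" .
    have "ln \<phi> - ln h = ln (\<phi> / h)" using phi h by (simp add: ln_div)
    also have "\<dots> \<le> \<phi> / h - 1" using phi h by (intro ln_le_minus_one) auto
    also have "\<dots> = (\<phi> - h) * (1 / h)" using h by (simp add: field_simps)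
    also have "\<dots> \<le> d * (1 / h)" using t h by (intro mult_right_mono) auto
    also have "\<dots> \<le> d * (1 / h) * (1 + x\<^sup>2)"
      using mult_left_mono[of 1 "1 + x\<^sup>2" "d * (1 / h)"] d h by simp
    finally have lnphi: "ln \<phi> - ln h \<le> d * (1 / h) * (1 + x\<^sup>2)" .
    have "d * A * (1 + x\<^sup>2) = d * (C * b * a) * (2 * (2 + R)\<^sup>2 * (1 + x\<^sup>2)) + d * (1 / h) * (1 + x\<^sup>2)"
      by (simp only: A_def distrib_right distrib_left mult.assoc)
    moreover have "d * A * (1 + x\<^sup>2) \<le> e * (1 + x\<^sup>2)" using d by (intro mult_right_mono) auto
    moreover have "- E + (p - c) \<le> q - c'"
      if "\<bar>p - q\<bar> \<le> m" "c' - c \<le> n" "N = m + n" "N \<le> E" for p q c c' m n N E :: real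
      using that by linarith
    ultimately have "- (e * (1 + x\<^sup>2)) + ln (K \<theta> h x) \<le> ln (K \<theta>' \<phi> x)"
      using lnk lnphi unfolding ln_K[OF h] ln_K[OF phi(2)] by blast
    then have "exp (- (e * (1 + x\<^sup>2)) + ln (K \<theta> h x)) \<le> exp (ln (K \<theta>' \<phi> x))"
      by (simp only: exp_le_cancel_iff)
    then show ?thesis
      using K_pos[OF h, of \<theta> x] K_pos[OF phi(2), of \<theta>' x] by (simp only: exp_add exp_ln)
  qed
  moreover have "d < h" using d h by simp
  ultimately show ?thesis using d(1) that by blast
qed

end

section \<open>Approximating a density by truncated kernel smoothing\<close>

lemma integral_Ico_pos:
  fixes f :: "real \<Rightarrow> real"
  assumes f: "integrable lborel f" "\<And>x. 0 < f x" and "a < b"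
  shows "0 < (\<integral>x. indicator {a..<b} x * f x \<partial>lborel)"
proof -
  have nonneg: "AE x in lborel. 0 \<le> indicator {a..<b} x * f x"
    using f(2)[THEN less_imp_le] by simp
  have int: "integrable lborel (\<lambda>x. indicator {a..<b} x * f x)"
    using integrable_mult_indicator[OF _ f(1), of "{a..<b}"] by simp
  have "(\<integral>x. indicator {a..<b} x * f x \<partial>lborel) \<noteq> 0"
  proof
    assume "(\<integral>x. indicator {a..<b} x * f x \<partial>lborel) = 0"
    then have "AE x in lborel. indicator {a..<b} x * f x = 0"
      using integral_nonneg_eq_0_iff_AE[OF int nonneg] by simp
    then have "AE x in lborel. x \<notin> {a..<b}"
    proof eventually_elim
      case (elim x)
      then show ?case using f(2)[of x] by (auto simp: indicator_def split: if_splits)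
    qed
    then have "emeasure lborel {a..<b} = 0"
      by (subst (asm) AE_iff_null_sets[symmetric]) auto
    then show False using \<open>a < b\<close> by simp
  qed
  moreover have "0 \<le> (\<integral>x. indicator {a..<b} x * f x \<partial>lborel)"
    by (rule integral_nonneg_AE[OF nonneg])
  ultimately show ?thesis by simp
qed

lemma abs_ln_ratio_le:
  fixes a g :: real
  assumes "0 < a" "0 < l" "l \<le> g" "g \<le> M"
  shows "\<bar>ln (a / g)\<bar> \<le> \<bar>ln a\<bar> + \<bar>ln M\<bar> + \<bar>ln (a / l)\<bar>"
proof -
  have "ln l \<le> ln g" "ln g \<le> ln M" using assms by (auto intro!: ln_mono)
  moreover have "ln (a / g) = ln a - ln g" "ln (a / l) = ln a - ln l"
    using assms by (auto simp: ln_div)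
  ultimately show ?thesis by linarith
qed

text \<open>
  The second moment of \<open>f0\<close> is matched to the kernel: it makes errors of size \<open>1 + x\<^sup>2\<close> in \<open>ln k\<close> integrable
  against \<open>f0\<close>.
\<close>

locale kernel_approximation = log_quadratic_kernel +
  fixes f0 :: "real \<Rightarrow> real" and M \<delta> :: real
  assumes f0_continuous: "continuous_on UNIV f0"
    and f0_total: "(\<integral>\<^sup>+x. ennreal (f0 x) \<partial>lborel) = 1"
    and f0_pos: "0 < f0 x"
    and f0_le: "f0 x \<le> M"
    and entropy: "integrable lborel (\<lambda>x. f0 x * ln (f0 x))"
    and delta_pos: "0 < \<delta>"
    and local_inf: "integrable lborel (\<lambda>x. f0 x * ln (f0 x / (INF t\<in>{t. \<bar>t - x\<bar> < \<delta>}. f0 t)))"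
    and second_moment: "integrable lborel (\<lambda>x. x\<^sup>2 * f0 x)"
begin

lemma f0_measurable [measurable]: "f0 \<in> borel_measurable borel"
  by (rule borel_measurable_continuous_onI[OF f0_continuous])

lemma f0_integrable: "integrable lborel f0"
  using f0_total f0_pos[THEN less_imp_le] by (intro integrableI_nonneg) auto

lemma M_pos: "0 < M"
  using f0_pos[of 0] f0_le[of 0] by simp

lemma integrable_f0_quadratic: "integrable lborel (\<lambda>x. f0 x * (a + b * x\<^sup>2))"
proof -
  have "integrable lborel (\<lambda>x. a * f0 x + b * (x\<^sup>2 * f0 x))"
    by (intro Bochner_Integration.integrable_add integrable_mult_right f0_integrable second_moment)
  also have "(\<lambda>x. a * f0 x + b * (x\<^sup>2 * f0 x)) = (\<lambda>x. f0 x * (a + b * x\<^sup>2))"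
    by (auto simp: algebra_simps)
  finally show ?thesis .
qed

text \<open>
  Smoothing of \<open>f0\<close> restricted to \<open>A\<close>. The truncated densities, the full convolution and the contribution
  of a single cell are all of this form.
\<close>

definition smoothed :: "real set \<Rightarrow> real \<Rightarrow> real \<Rightarrow> real" where
  "smoothed A h x = (\<integral>\<theta>. (indicator A \<theta> * f0 \<theta>) * K \<theta> h x \<partial>lborel)"

lemma smoothed_eq:
  assumes "0 < h"
  shows "smoothed A h x = (\<integral>u. (indicator A (x - h * u) * f0 (x - h * u)) * k u \<partial>lborel)"
  unfolding smoothed_def using assms by (rule K_substitution)

lemma f0_k_bound: "norm (indicator A t * f0 t * k u) \<le> M * k u"
  using f0_pos[of t] f0_le[of t] M_pos k_pos[of u] by (auto simp: indicator_def abs_mult)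

lemma integrable_smoothed_u:
  assumes [measurable]: "A \<in> sets borel"
  shows "integrable lborel (\<lambda>u. (indicator A (x - h * u) * f0 (x - h * u)) * k u)"
proof (rule Bochner_Integration.integrable_bound)
  show "integrable lborel (\<lambda>u. M * k u)" by (intro integrable_mult_right integrable_k)
  show "AE u in lborel. norm (indicator A (x - h * u) * f0 (x - h * u) * k u) \<le> norm (M * k u)"
    by (intro AE_I2 order_trans[OF f0_k_bound]) simp
qed measurable

lemma integrable_smoothed:
  assumes "0 < h" "A \<in> sets borel"
  shows "integrable lborel (\<lambda>\<theta>. (indicator A \<theta> * f0 \<theta>) * K \<theta> h x)"
  by (rule integrable_K_substitution[OF assms(1) integrable_smoothed_u[OF assms(2)]])

lemma smoothed_le:
  assumes "0 < h" "A \<in> sets borel"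
  shows "smoothed A h x \<le> M"
proof -
  have "smoothed A h x \<le> (\<integral>u. M * k u \<partial>lborel)"
    unfolding smoothed_eq[OF assms(1)]
    by (intro integral_mono integrable_smoothed_u integrable_mult_right integrable_k assms
        order_trans[OF abs_ge_self f0_k_bound[unfolded real_norm_def]])
  then show ?thesis by (simp add: integral_k)
qed

lemma smoothed_mono:
  assumes "0 < h" "A \<in> sets borel" "B \<in> sets borel" "A \<subseteq> B"
  shows "smoothed A h x \<le> smoothed B h x"
  unfolding smoothed_def
proof (intro integral_mono integrable_smoothed assms(1-3))
  show "indicator A \<theta> * f0 \<theta> * K \<theta> h x \<le> indicator B \<theta> * f0 \<theta> * K \<theta> h x" for \<theta>
    using assms(4) K_pos[OF assms(1), of \<theta> x] f0_pos[of \<theta>] by (auto simp: indicator_def)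
qed

lemma smoothed_measurable [measurable]:
  assumes [measurable]: "A \<in> sets borel"
  shows "smoothed A h \<in> borel_measurable borel"
  unfolding smoothed_def by measurable

lemma smoothed_tendsto_f0:
  assumes h: "\<And>i. 0 < h i" "h \<longlonglongrightarrow> 0"
  shows "(\<lambda>i. smoothed UNIV (h i) x) \<longlonglongrightarrow> f0 x"
proof -
  have "(\<lambda>i. \<integral>u. (indicator UNIV (x - h i * u) * f0 (x - h i * u)) * k u \<partial>lborel)
      \<longlonglongrightarrow> (\<integral>u. f0 x * k u \<partial>lborel)"
  proof (rule integral_dominated_convergence)
    show "integrable lborel (\<lambda>u. M * k u)" by (intro integrable_mult_right integrable_k)
    show "AE u in lborel. (\<lambda>i. (indicator UNIV (x - h i * u) * f0 (x - h i * u)) * k u) \<longlonglongrightarrow> f0 x * k u"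
    proof (rule AE_I2)
      fix u
      have "(\<lambda>i. x - h i * u) \<longlonglongrightarrow> x - 0 * u" by (intro tendsto_intros h)
      then have "(\<lambda>i. f0 (x - h i * u)) \<longlonglongrightarrow> f0 x"
        using f0_continuous by (intro continuous_on_tendsto_compose[OF f0_continuous]) auto
      then show "(\<lambda>i. (indicator UNIV (x - h i * u) * f0 (x - h i * u)) * k u) \<longlonglongrightarrow> f0 x * k u"
        by (auto intro: tendsto_mult_right)
    qed
    show "AE u in lborel. norm ((indicator UNIV (x - h i * u) * f0 (x - h i * u)) * k u) \<le> M * k u" for i
      by (intro AE_I2 f0_k_bound)
  qed measurable
  then show ?thesis by (simp add: smoothed_eq[OF h(1)] integral_k)
qed

lemma smoothed_truncation_tendsto:
  assumes h: "0 < h"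
  shows "(\<lambda>n. smoothed {- real (Suc n)..<real (Suc n)} h x) \<longlonglongrightarrow> smoothed UNIV h x"
  unfolding smoothed_def
proof (rule integral_dominated_convergence)
  show "integrable lborel (\<lambda>\<theta>. indicator UNIV \<theta> * f0 \<theta> * K \<theta> h x)"
    by (rule integrable_smoothed) (use h in auto)
  show "AE \<theta> in lborel. (\<lambda>n. indicator {- real (Suc n)..<real (Suc n)} \<theta> * f0 \<theta> * K \<theta> h x)
      \<longlonglongrightarrow> indicator UNIV \<theta> * f0 \<theta> * K \<theta> h x"
  proof (rule AE_I2)
    fix \<theta> :: real
    obtain N where N: "\<bar>\<theta>\<bar> < real N" using reals_Archimedean2 by blast
    have "eventually (\<lambda>n. indicator {- real (Suc n)..<real (Suc n)} \<theta> * f0 \<theta> * K \<theta> h x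
        = indicator UNIV \<theta> * f0 \<theta> * K \<theta> h x) sequentially"
      using eventually_ge_at_top[of N]
    proof eventually_elim
      case (elim n)
      then have "\<theta> \<in> {- real (Suc n)..<real (Suc n)}" using N by auto
      then show ?case by simp
    qed
    then show "(\<lambda>n. indicator {- real (Suc n)..<real (Suc n)} \<theta> * f0 \<theta> * K \<theta> h x)
      \<longlonglongrightarrow> indicator UNIV \<theta> * f0 \<theta> * K \<theta> h x"
      by (rule tendsto_eventually)
  qed
  show "AE \<theta> in lborel. norm (indicator {- real (Suc n)..<real (Suc n)} \<theta> * f0 \<theta> * K \<theta> h x)
      \<le> indicator UNIV \<theta> * f0 \<theta> * K \<theta> h x" for n
    using K_pos[OF h] f0_pos by (intro AE_I2) (auto simp: indicator_def abs_mult less_imp_le abs_of_pos)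
qed measurable

lemma f0_log_ratio_bound:
  assumes "0 < l" "l \<le> g" "g \<le> M"
  shows "norm (f0 x * ln (f0 x / g)) \<le> norm (f0 x * ln (f0 x)) + f0 x * \<bar>ln M\<bar> + norm (f0 x * ln (f0 x / l))"
proof -
  have "norm (f0 x * ln (f0 x / g)) = f0 x * \<bar>ln (f0 x / g)\<bar>"
    using f0_pos[of x] by (simp add: abs_mult)
  also have "\<dots> \<le> f0 x * (\<bar>ln (f0 x)\<bar> + \<bar>ln M\<bar> + \<bar>ln (f0 x / l)\<bar>)"
    using f0_pos[of x] assms by (intro mult_left_mono abs_ln_ratio_le) auto
  also have "\<dots> = norm (f0 x * ln (f0 x)) + f0 x * \<bar>ln M\<bar> + norm (f0 x * ln (f0 x / l))"
    using f0_pos[of x] by (simp add: abs_mult distrib_left)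
  finally show ?thesis .
qed

text \<open>
  A common integrable minorant \<open>l\<close> (in the sense of \<open>f0 ln (f0 / l)\<close>) and the majorant \<open>M\<close> control
  \<open>\<bar>ln (f0 / g)\<bar>\<close> from both sides.
\<close>

lemma kl_integrand_dominated:
  assumes l: "\<And>x. 0 < l x" "integrable lborel (\<lambda>x. f0 x * ln (f0 x / l x))"
    and g: "\<And>n x. l x \<le> g n x" "\<And>n x. g n x \<le> M" "\<And>x. (\<lambda>n. g n x) \<longlonglongrightarrow> G x"
    and [measurable]: "\<And>n. g n \<in> borel_measurable borel" "G \<in> borel_measurable borel"
  shows "(\<lambda>n. \<integral>x. f0 x * ln (f0 x / g n x) \<partial>lborel) \<longlonglongrightarrow> (\<integral>x. f0 x * ln (f0 x / G x) \<partial>lborel)"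
    and "integrable lborel (\<lambda>x. f0 x * ln (f0 x / g n x))"
proof -
  let ?w = "\<lambda>x. norm (f0 x * ln (f0 x)) + f0 x * \<bar>ln M\<bar> + norm (f0 x * ln (f0 x / l x))"
  have w: "integrable lborel ?w"
    by (intro Bochner_Integration.integrable_add integrable_norm integrable_mult_left f0_integrable entropy l)
  have bound: "norm (f0 x * ln (f0 x / g n x)) \<le> ?w x" for n x
    by (rule f0_log_ratio_bound[OF l(1) g(1,2)])
  have conv: "(\<lambda>n. f0 x * ln (f0 x / g n x)) \<longlonglongrightarrow> f0 x * ln (f0 x / G x)" for x
  proof -
    have "l x \<le> G x" by (rule LIMSEQ_le_const[OF g(3)]) (use g(1) in auto)
    then have "0 < G x" using l(1)[of x] by simp
    then show ?thesis using f0_pos[of x] by (intro tendsto_intros g(3)) auto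
  qed
  show "(\<lambda>n. \<integral>x. f0 x * ln (f0 x / g n x) \<partial>lborel) \<longlonglongrightarrow> (\<integral>x. f0 x * ln (f0 x / G x) \<partial>lborel)"
    by (rule integral_dominated_convergence[where w = ?w]) (use w bound conv in auto)
  show "integrable lborel (\<lambda>x. f0 x * ln (f0 x / g n x))"
  proof (rule Bochner_Integration.integrable_bound[OF w])
    show "AE x in lborel. norm (f0 x * ln (f0 x / g n x)) \<le> norm (?w x)"
      by (intro AE_I2 order_trans[OF bound]) simp
  qed measurable
qed

definition local_infimum :: "real \<Rightarrow> real" where
  "local_infimum x = (INF t\<in>{t. \<bar>t - x\<bar> < \<delta>}. f0 t)"

lemma local_infimum_le: "\<bar>t - x\<bar> < \<delta> \<Longrightarrow> local_infimum x \<le> f0 t"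
  unfolding local_infimum_def
  by (rule cINF_lower) (auto intro!: bdd_belowI[of _ 0] f0_pos[THEN less_imp_le])

lemma local_infimum_pos: "0 < local_infimum x"
proof -
  have "\<exists>y\<in>{x - \<delta>..x + \<delta>}. \<forall>z\<in>{x - \<delta>..x + \<delta>}. f0 y \<le> f0 z"
    by (rule continuous_attains_inf)
      (use delta_pos in \<open>auto intro: continuous_on_subset[OF f0_continuous]\<close>)
  then obtain y where y: "\<And>z. z \<in> {x - \<delta>..x + \<delta>} \<Longrightarrow> f0 y \<le> f0 z" by blast
  have "f0 y \<le> local_infimum x"
    unfolding local_infimum_def using delta_pos
    by (intro cINF_greatest y) (auto intro: exI[of _ x])
  then show ?thesis using f0_pos[of y] by simp
qed

text \<open>
  For \<open>h < \<delta>\<close> the part \<open>\<bar>u\<bar> \<le> 1\<close> of the convolution only sees values of \<open>f0\<close> at distance less than \<open>\<delta>\<close>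
  from \<open>x\<close>. The constant in front does not depend on \<open>h\<close>, so that the bound is uniform as \<open>h \<rightarrow> 0\<close>.
\<close>

lemma smoothed_ge_local_infimum:
  assumes h: "0 < h" "h < \<delta>"
  shows "(\<integral>u. indicator {-1..<1} u * k u \<partial>lborel) * local_infimum x \<le> smoothed UNIV h x"
proof -
  have "(\<integral>u. indicator {-1..<1} u * k u \<partial>lborel) * local_infimum x
      = (\<integral>u. indicator {-1..<1} u * k u * local_infimum x \<partial>lborel)"
    by simp
  also have "\<dots> \<le> smoothed UNIV h x"
    unfolding smoothed_eq[OF h(1)]
  proof (intro integral_mono integrable_smoothed_u)
    show "integrable lborel (\<lambda>u. indicator {-1..<1} u * k u * local_infimum x)"
      using integrable_mult_indicator[OF _ integrable_k, of "{-1..<1}"]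
      by (intro integrable_mult_left) simp
    show "indicator {-1..<1} u * k u * local_infimum x
        \<le> indicator UNIV (x - h * u) * f0 (x - h * u) * k u" for u
    proof (cases "u \<in> {-1..<1}")
      case True
      then have "h * \<bar>u\<bar> \<le> h * 1" using h by (intro mult_left_mono) auto
      then have "h * \<bar>u\<bar> < \<delta>" using h by linarith
      then have "\<bar>(x - h * u) - x\<bar> < \<delta>" using h by (simp add: abs_mult)
      from local_infimum_le[OF this] True show ?thesis using k_pos[of u] by simp
    qed (use f0_pos[of "x - h * u"] k_pos[of u] in simp)
  qed simp
  finally show ?thesis .
qed

text \<open>
  Minorant for every truncation to \<open>[-m, m)\<close> with \<open>m \<ge> 1\<close>, because these increase with \<open>m\<close>.
\<close>

lemma smoothed_truncation_ge:
  assumes h: "0 < h"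
  obtains A where "\<And>x. exp (- (A * (1 + x\<^sup>2))) * (\<integral>\<theta>. indicator {-1..<1} \<theta> * f0 \<theta> \<partial>lborel)
    \<le> smoothed {-1..<1} h x"
proof -
  obtain A where A: "\<And>\<theta> x. \<bar>\<theta>\<bar> \<le> 1 \<Longrightarrow> exp (- (A * (1 + x\<^sup>2))) \<le> K \<theta> h x"
    using K_lower_bound[OF h, of 1] by auto
  have "exp (- (A * (1 + x\<^sup>2))) * (\<integral>\<theta>. indicator {-1..<1} \<theta> * f0 \<theta> \<partial>lborel)
    \<le> smoothed {-1..<1} h x" for x
  proof -
    have "exp (- (A * (1 + x\<^sup>2))) * (\<integral>\<theta>. indicator {-1..<1} \<theta> * f0 \<theta> \<partial>lborel)
        = (\<integral>\<theta>. indicator {-1..<1} \<theta> * f0 \<theta> * exp (- (A * (1 + x\<^sup>2))) \<partial>lborel)"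
      by simp
    also have "\<dots> \<le> smoothed {-1..<1} h x"
      unfolding smoothed_def
    proof (intro integral_mono integrable_smoothed h)
      show "integrable lborel (\<lambda>\<theta>. indicator {-1..<1} \<theta> * f0 \<theta> * exp (- (A * (1 + x\<^sup>2))))"
        using integrable_mult_indicator[OF _ f0_integrable, of "{-1..<1}"]
        by (intro integrable_mult_left) simp
      show "indicator {-1..<1} \<theta> * f0 \<theta> * exp (- (A * (1 + x\<^sup>2)))
          \<le> indicator {-1..<1} \<theta> * f0 \<theta> * K \<theta> h x" for \<theta>
        using A[of \<theta> x] f0_pos[of \<theta>] by (auto simp: indicator_def abs_le_iff)
    qed simp
    finally show ?thesis .
  qed
  then show ?thesis by (rule that)
qed

lemma smoothed_kl_small:
  assumes "0 < \<epsilon>"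
  obtains h where "0 < h" "(\<integral>x. f0 x * ln (f0 x / smoothed UNIV h x) \<partial>lborel) < \<epsilon>"
proof -
  define c where "c = (\<integral>u. indicator {-1..<1} u * k u \<partial>lborel)"
  have c: "0 < c" unfolding c_def by (rule integral_Ico_pos) (auto simp: integrable_k k_pos)
  \<comment> \<open>Half of \<open>\<delta>\<close>, because \<open>smoothed_ge_local_infimum\<close> needs a strict inequality.\<close>
  define h where "h i = \<delta> / 2 / real (Suc i)" for i
  have h: "0 < h i" "h i < \<delta>" for i
  proof -
    show "0 < h i" using delta_pos by (simp add: h_def)
    have "h i \<le> \<delta> / 2 / 1" unfolding h_def using delta_pos by (intro divide_left_mono) auto
    then show "h i < \<delta>" using delta_pos by simp
  qed
  have "(\<lambda>i. \<delta> / 2 * inverse (real (Suc i))) \<longlonglongrightarrow> \<delta> / 2 * 0"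
    by (intro tendsto_intros LIMSEQ_inverse_real_of_nat)
  moreover have "h = (\<lambda>i. \<delta> / 2 * inverse (real (Suc i)))"
    by (rule ext) (simp only: h_def divide_inverse)
  ultimately have h0: "h \<longlonglongrightarrow> 0" by simp
  have "(\<lambda>i. \<integral>x. f0 x * ln (f0 x / smoothed UNIV (h i) x) \<partial>lborel)
      \<longlonglongrightarrow> (\<integral>x. f0 x * ln (f0 x / f0 x) \<partial>lborel)"
  proof (rule kl_integrand_dominated(1)[where l = "\<lambda>x. c * local_infimum x"])
    show "0 < c * local_infimum x" for x using c local_infimum_pos[of x] by simp
    have "integrable lborel (\<lambda>x. f0 x * ln (f0 x / local_infimum x) - f0 x * ln c)"
      using local_inf by (intro Bochner_Integration.integrable_diff integrable_mult_left f0_integrable)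
        (simp add: local_infimum_def)
    also have "(\<lambda>x. f0 x * ln (f0 x / local_infimum x) - f0 x * ln c) = (\<lambda>x. f0 x * ln (f0 x / (c * local_infimum x)))"
    proof
      fix x
      show "f0 x * ln (f0 x / local_infimum x) - f0 x * ln c = f0 x * ln (f0 x / (c * local_infimum x))"
        using c local_infimum_pos[of x] f0_pos[of x] by (simp add: ln_div ln_mult_pos algebra_simps)
    qed
    finally show "integrable lborel (\<lambda>x. f0 x * ln (f0 x / (c * local_infimum x)))" .
    show "c * local_infimum x \<le> smoothed UNIV (h i) x" for i x
      unfolding c_def by (rule smoothed_ge_local_infimum[OF h])
    show "smoothed UNIV (h i) x \<le> M" for i x by (rule smoothed_le[OF h(1)]) simp
    show "(\<lambda>i. smoothed UNIV (h i) x) \<longlonglongrightarrow> f0 x" for x by (rule smoothed_tendsto_f0[OF h(1) h0])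
  qed measurable
  also have "(\<lambda>x. f0 x * ln (f0 x / f0 x)) = (\<lambda>_. 0)"
    using f0_pos[THEN less_imp_neq, THEN not_sym] by auto
  finally have "(\<lambda>i. \<integral>x. f0 x * ln (f0 x / smoothed UNIV (h i) x) \<partial>lborel) \<longlonglongrightarrow> 0" by simp
  from order_tendstoD(2)[OF this assms]
  obtain i where "(\<integral>x. f0 x * ln (f0 x / smoothed UNIV (h i) x) \<partial>lborel) < \<epsilon>"
    by (auto simp: eventually_sequentially)
  then show ?thesis using that h(1) by blast
qed

lemma truncated_kl_small:
  assumes "0 < \<epsilon>"
  obtains h n where "0 < h" "integrable lborel (\<lambda>x. f0 x * ln (f0 x / smoothed {- real (Suc n)..<real (Suc n)} h x))"
    "(\<integral>x. f0 x * ln (f0 x / smoothed {- real (Suc n)..<real (Suc n)} h x) \<partial>lborel) < \<epsilon>"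
    "\<And>x. 0 < smoothed {- real (Suc n)..<real (Suc n)} h x"
proof -
  obtain h where h: "0 < h" and small: "(\<integral>x. f0 x * ln (f0 x / smoothed UNIV h x) \<partial>lborel) < \<epsilon>"
    using smoothed_kl_small[OF assms] .
  define c where "c = (\<integral>\<theta>. indicator {-1..<1} \<theta> * f0 \<theta> \<partial>lborel)"
  have c: "0 < c" unfolding c_def by (rule integral_Ico_pos) (auto simp: f0_integrable f0_pos)
  obtain A where A: "\<And>x. exp (- (A * (1 + x\<^sup>2))) * c \<le> smoothed {-1..<1} h x"
    using smoothed_truncation_ge[OF h] unfolding c_def by blast
  let ?l = "\<lambda>x. exp (- (A * (1 + x\<^sup>2))) * c"
  let ?g = "\<lambda>n. smoothed {- real (Suc n)..<real (Suc n)} h"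
  have l: "0 < ?l x" for x using c by simp
  have lg: "?l x \<le> ?g n x" for n x
    by (rule order_trans[OF A smoothed_mono[OF h]]) auto
  have gM: "?g n x \<le> M" for n x by (rule smoothed_le[OF h]) simp
  have "integrable lborel (\<lambda>x. f0 x * ln (f0 x) + f0 x * ((A - ln c) + A * x\<^sup>2))"
    by (intro Bochner_Integration.integrable_add entropy integrable_f0_quadratic)
  also have "(\<lambda>x. f0 x * ln (f0 x) + f0 x * ((A - ln c) + A * x\<^sup>2)) = (\<lambda>x. f0 x * ln (f0 x / ?l x))"
  proof
    fix x
    show "f0 x * ln (f0 x) + f0 x * ((A - ln c) + A * x\<^sup>2) = f0 x * ln (f0 x / ?l x)"
      using c f0_pos[of x] by (simp add: ln_div ln_mult_pos algebra_simps)
  qed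
  finally have int: "integrable lborel (\<lambda>x. f0 x * ln (f0 x / ?l x))" .
  note dom = kl_integrand_dominated[OF l int lg gM smoothed_truncation_tendsto[OF h]]
  have "(\<lambda>n. \<integral>x. f0 x * ln (f0 x / ?g n x) \<partial>lborel) \<longlonglongrightarrow> (\<integral>x. f0 x * ln (f0 x / smoothed UNIV h x) \<partial>lborel)"
    by (rule dom(1)) measurable
  from order_tendstoD(2)[OF this small]
  obtain n where n: "(\<integral>x. f0 x * ln (f0 x / ?g n x) \<partial>lborel) < \<epsilon>"
    by (auto simp: eventually_sequentially)
  have "integrable lborel (\<lambda>x. f0 x * ln (f0 x / ?g n x))" by (rule dom(2)) measurable
  moreover have "0 < ?g n x" for x using l[of x] lg[of x n] by linarith
  ultimately show ?thesis using that h n by blast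
qed

end

section \<open>Measurability of the Kullback-Leibler divergence\<close>

text \<open>
  Each ingredient of the definition of \<open>KL_dens\<close> - almost sure positivity, integrability, the value -
  is expressed by an integral depending on the parameter \<open>\<omega>\<close>, which is measurable in \<open>\<omega>\<close>.
\<close>

lemma KL_dens_sublevel_sets:
  assumes [measurable]: "f0 \<in> borel_measurable borel"
    and F [measurable]: "(\<lambda>(\<omega>, x). F \<omega> x) \<in> borel_measurable (M \<Otimes>\<^sub>M lborel)"
  shows "{\<omega> \<in> space M. KL_dens f0 (F \<omega>) < ereal \<epsilon>} \<in> sets M"
proof -
  let ?g = "\<lambda>\<omega> x. f0 x * ln (f0 x / F \<omega> x)"
  let ?bad = "\<lambda>\<omega>. \<integral>\<^sup>+x. (if f0 x > 0 \<longrightarrow> F \<omega> x > 0 then 0 else 1) \<partial>lborel"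
  let ?abs = "\<lambda>\<omega>. \<integral>\<^sup>+x. ennreal (norm (?g \<omega> x)) \<partial>lborel"
  have F_section [measurable]: "F \<omega> \<in> borel_measurable lborel" if "\<omega> \<in> space M" for \<omega>
    using measurable_Pair2[OF F that] by simp
  have g [measurable]: "(\<lambda>(\<omega>, x). ?g \<omega> x) \<in> borel_measurable (M \<Otimes>\<^sub>M lborel)"
    by measurable
  have bad [measurable]: "?bad \<in> borel_measurable M"
    by (rule lborel.borel_measurable_nn_integral) measurable
  have abs [measurable]: "?abs \<in> borel_measurable M"
    by (rule lborel.borel_measurable_nn_integral) measurable
  have int [measurable]: "(\<lambda>\<omega>. \<integral>x. ?g \<omega> x \<partial>lborel) \<in> borel_measurable M"
    by (rule lborel.borel_measurable_lebesgue_integral[OF g])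
  have "KL_dens f0 (F \<omega>) < ereal \<epsilon> \<longleftrightarrow> ?bad \<omega> = 0 \<and> ?abs \<omega> < \<infinity> \<and> (\<integral>x. ?g \<omega> x \<partial>lborel) < \<epsilon>"
    if \<omega>: "\<omega> \<in> space M" for \<omega>
  proof -
    note [measurable] = F_section[OF \<omega>]
    have "?bad \<omega> = 0 \<longleftrightarrow> (AE x in lborel. (if f0 x > 0 \<longrightarrow> F \<omega> x > 0 then 0 else 1) = (0::ennreal))"
      by (rule nn_integral_0_iff_AE) measurable
    also have "\<dots> \<longleftrightarrow> (AE x in lborel. f0 x > 0 \<longrightarrow> F \<omega> x > 0)"
      by (intro AE_cong) auto
    finally have "?bad \<omega> = 0 \<longleftrightarrow> (AE x in lborel. f0 x > 0 \<longrightarrow> F \<omega> x > 0)" .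
    moreover have "?abs \<omega> < \<infinity> \<longleftrightarrow> integrable lborel (?g \<omega>)"
      by (simp add: integrable_iff_bounded)
    ultimately show ?thesis unfolding KL_dens_def by auto
  qed
  then have "{\<omega> \<in> space M. KL_dens f0 (F \<omega>) < ereal \<epsilon>}
      = {\<omega> \<in> space M. ?bad \<omega> = 0 \<and> ?abs \<omega> < \<infinity> \<and> (\<integral>x. ?g \<omega> x \<partial>lborel) < \<epsilon>}"
    by (intro Collect_cong conj_cong) simp_all
  also have "\<dots> \<in> sets M" by measurable
  finally show ?thesis .
qed

text \<open>
  The set of parameters with small divergence has to be shown measurable before its image under the law
  can be given a positive measure: the measure of a set outside the \<open>\<sigma>\<close>-algebra is 0 by convention. For
  the same reason positive measure makes \<open>V\<close> measurable.
\<close>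

lemma KL_law_positive:
  assumes f0: "f0 \<in> borel_measurable borel"
    and X: "\<And>\<omega>. \<omega> \<in> space M \<Longrightarrow> X \<omega> \<in> prob_densities"
    and F: "(\<lambda>(\<omega>, x). X \<omega> x) \<in> borel_measurable (M \<Otimes>\<^sub>M lborel)"
    and V: "0 < emeasure M V" "\<And>\<omega>. \<omega> \<in> V \<Longrightarrow> KL_dens f0 (X \<omega>) < ereal \<epsilon>"
  shows "0 < emeasure (law M prob_densities X)
    {f \<in> space (law M prob_densities X). KL_dens f0 f < ereal \<epsilon>}"
proof -
  let ?A = "{f \<in> prob_densities. KL_dens f0 f < ereal \<epsilon>}"
  let ?B = "{\<omega> \<in> space M. KL_dens f0 (X \<omega>) < ereal \<epsilon>}"
  have eq: "X -` ?A \<inter> space M = ?B" using X by auto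
  have B: "?B \<in> sets M" by (rule KL_dens_sublevel_sets[OF f0 F])
  have Vsets: "V \<in> sets M" using V(1) emeasure_notin_sets[of V M] by (cases "V \<in> sets M") auto
  have "V \<subseteq> ?B" using sets.sets_into_space[OF Vsets] V(2) by auto
  then have "0 < emeasure M ?B" by (rule order_less_le_trans[OF V(1) emeasure_mono[OF _ B]])
  also have "emeasure M ?B = emeasure (law M prob_densities X) ?A"
    by (subst emeasure_law) (use X B eq in auto)
  finally show ?thesis by (simp add: law_def space_measure_of_conv)
qed

section \<open>Mixtures of a location-scale kernel\<close>

context log_quadratic_kernel
begin

text \<open>
  The double integral over \<open>x\<close> and the mixing measure is 1 by Tonelli, hence the mixture integral
  converges for almost all \<open>x\<close>. On the exceptional null set it has the default value 0.
\<close>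

lemma mixture_density:
  fixes t p :: "'a \<Rightarrow> real"
  assumes P: "prob_space P"
    and [measurable]: "t \<in> borel_measurable P" "p \<in> borel_measurable P"
    and p: "\<And>y. y \<in> space P \<Longrightarrow> 0 < p y"
  shows "AE x in lborel. integrable P (\<lambda>y. K (t y) (p y) x)" (is ?int)
    and "(\<lambda>x. \<integral>y. K (t y) (p y) x \<partial>P) \<in> prob_densities" (is ?dens)
proof -
  interpret prob_space P by (rule P)
  interpret pair: pair_sigma_finite P lborel ..
  let ?k = "\<lambda>y x. K (t y) (p y) x"
  have nonneg: "AE y in P. 0 \<le> ?k y x" for x
    by (intro AE_I2 less_imp_le K_pos p)
  have total: "(\<integral>\<^sup>+x. (\<integral>\<^sup>+y. ennreal (?k y x) \<partial>P) \<partial>lborel) = 1"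
  proof -
    have "(\<integral>\<^sup>+x. (\<integral>\<^sup>+y. ennreal (?k y x) \<partial>P) \<partial>lborel) = (\<integral>\<^sup>+y. (\<integral>\<^sup>+x. ennreal (?k y x) \<partial>lborel) \<partial>P)"
      by (rule pair.Fubini') measurable
    also have "\<dots> = (\<integral>\<^sup>+y. 1 \<partial>P)" by (intro nn_integral_cong nn_integral_K p)
    finally show ?thesis by (simp add: emeasure_space_1)
  qed
  have "AE x in lborel. (\<integral>\<^sup>+y. ennreal (?k y x) \<partial>P) \<noteq> \<infinity>"
    by (rule nn_integral_PInf_AE) (use total in simp_all)
  then show ?int
  proof eventually_elim
    case (elim x)
    then show ?case
      by (intro integrableI_nonneg nonneg) (auto simp: top.not_eq_extremum)
  qed
  then have "(\<integral>\<^sup>+x. ennreal (\<integral>y. ?k y x \<partial>P) \<partial>lborel) = (\<integral>\<^sup>+x. (\<integral>\<^sup>+y. ennreal (?k y x) \<partial>P) \<partial>lborel)"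
    by (intro nn_integral_cong_AE) (auto elim!: eventually_mono simp: nn_integral_eq_integral nonneg)
  moreover have "0 \<le> (\<integral>y. ?k y x \<partial>P)" for x by (rule integral_nonneg_AE[OF nonneg])
  ultimately show ?dens by (simp add: prob_densities_def total)
qed

end

section \<open>Weak neighbourhoods\<close>

lemma space_prob_measures: "P \<in> space (prob_measures S) \<longleftrightarrow> sets P = sets (restrict_space borel S) \<and> prob_space P"
  by (simp add: prob_measures_def space_prob_algebra)

lemma openin_weak_topology:
  fixes g :: "'a::topological_space \<Rightarrow> real"
  assumes "continuous_on S g" "bounded (g ` S)" "open U"
  shows "openin (weak_topology S) {P \<in> space (prob_measures S). (\<integral>x. g x \<partial>P) \<in> U}"
  unfolding weak_topology_def
  by (rule topology_generated_by_Basis, intro CollectI exI[of _ g] exI[of _ U] conjI refl assms)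

text \<open>
  Finitely many strict lower bounds on integrals of bounded continuous functions define a basic weakly
  open set.
\<close>

lemma full_support_neighbourhood:
  fixes g :: "'j \<Rightarrow> 'a::topological_space \<Rightarrow> real"
  assumes Q: "measure_support (weak_topology S) Q = space (prob_measures S)"
    and P0: "P0 \<in> space (prob_measures S)"
    and J: "finite J" "\<And>j. j \<in> J \<Longrightarrow> continuous_on S (g j)" "\<And>j. j \<in> J \<Longrightarrow> bounded (g j ` S)"
    and b: "\<And>j. j \<in> J \<Longrightarrow> b j < (\<integral>x. g j x \<partial>P0)"
  shows "0 < emeasure Q {P \<in> space (prob_measures S). \<forall>j\<in>J. b j < (\<integral>x. g j x \<partial>P)}"
proof -
  let ?U = "\<lambda>j. {P \<in> space (prob_measures S). (\<integral>x. g j x \<partial>P) \<in> {b j<..}}"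
  let ?N = "(\<Inter>j\<in>J. ?U j) \<inter> topspace (weak_topology S)"
  have "openin (weak_topology S) ?N"
    by (intro openin_INT openin_weak_topology J open_greaterThan)
  moreover have "P0 \<in> ?N" using P0 b by (simp add: topspace_weak_topology)
  moreover have "P0 \<in> measure_support (weak_topology S) Q" using P0 Q by simp
  ultimately have "0 < emeasure Q ?N" by (simp add: measure_support_def)
  also have "?N = {P \<in> space (prob_measures S). \<forall>j\<in>J. b j < (\<integral>x. g j x \<partial>P)}"
    by (auto simp: topspace_weak_topology)
  finally show ?thesis .
qed

section \<open>Finitely many test functions control the divergence\<close>

text \<open>
  On the support of \<open>W\<^sub>j\<close> the function \<open>F\<close> is at least \<open>G\<^sub>j / b\<^sub>j\<close>, so \<open>F \<ge> \<Sum>\<^sub>j (G\<^sub>j / b\<^sub>j) W\<^sub>j\<close> because the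
  weights add up to at most 1; integrate and use that \<open>W\<^sub>j\<close> has integral at least \<open>c b\<^sub>j\<close>. In the
  application \<open>F\<close> is a kernel, \<open>b\<^sub>j\<close> the mass of a cell and \<open>G\<^sub>j\<close> the share of that cell in the smoothed
  density.
\<close>

lemma weighted_lower_bound:
  fixes F :: "'a \<Rightarrow> real" and W :: "'j \<Rightarrow> 'a \<Rightarrow> real"
  assumes P: "prob_space P"
    and F: "integrable P F" "\<And>y. y \<in> space P \<Longrightarrow> 0 \<le> F y"
    and J: "finite J"
    and W: "\<And>j. j \<in> J \<Longrightarrow> W j \<in> borel_measurable P"
      "\<And>j y. j \<in> J \<Longrightarrow> y \<in> space P \<Longrightarrow> 0 \<le> W j y"
      "\<And>y. y \<in> space P \<Longrightarrow> (\<Sum>j\<in>J. W j y) \<le> 1"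
    and G: "\<And>j. j \<in> J \<Longrightarrow> 0 \<le> G j" "\<And>j. j \<in> J \<Longrightarrow> 0 < b j"
      "\<And>j y. j \<in> J \<Longrightarrow> y \<in> space P \<Longrightarrow> 0 < W j y \<Longrightarrow> G j \<le> b j * F y"
    and mass: "\<And>j. j \<in> J \<Longrightarrow> c * b j \<le> (\<integral>y. W j y \<partial>P)"
  shows "c * (\<Sum>j\<in>J. G j) \<le> (\<integral>y. F y \<partial>P)"
proof -
  interpret prob_space P by (rule P)
  have W1: "W j y \<le> 1" if "j \<in> J" "y \<in> space P" for j y
    using member_le_sum[of j J "\<lambda>j. W j y"] W(2,3) J that by fastforce
  have Wint: "integrable P (W j)" if "j \<in> J" for j
    by (rule integrable_const_bound[of _ 1]) (use W(1,2) W1 that in auto)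
  have "c * (\<Sum>j\<in>J. G j) = (\<Sum>j\<in>J. G j / b j * (c * b j))"
    using G(2) by (force simp: sum_distrib_left intro!: sum.cong)
  also have "\<dots> \<le> (\<Sum>j\<in>J. G j / b j * (\<integral>y. W j y \<partial>P))"
    using G(1,2) by (intro sum_mono mult_left_mono mass) (auto intro!: divide_nonneg_pos)
  also have "\<dots> = (\<integral>y. (\<Sum>j\<in>J. G j / b j * W j y) \<partial>P)"
    using Wint by (subst Bochner_Integration.integral_sum) auto
  also have "\<dots> \<le> (\<integral>y. F y \<partial>P)"
  proof (rule integral_mono)
    show "integrable P (\<lambda>y. \<Sum>j\<in>J. G j / b j * W j y)"
      using Wint by (intro Bochner_Integration.integrable_sum integrable_mult_right)
    show "(\<Sum>j\<in>J. G j / b j * W j y) \<le> F y" if y: "y \<in> space P" for y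
    proof -
      have "(\<Sum>j\<in>J. G j / b j * W j y) \<le> (\<Sum>j\<in>J. F y * W j y)"
      proof (rule sum_mono)
        fix j assume j: "j \<in> J"
        show "G j / b j * W j y \<le> F y * W j y"
        proof (cases "0 < W j y")
          case True
          then have "G j / b j \<le> F y"
            using G(3)[OF j y] G(2)[OF j] by (simp add: divide_le_eq mult.commute)
          then show ?thesis using True by (intro mult_right_mono) auto
        next
          case False
          then have "W j y = 0" using W(2)[OF j y] by simp
          then show ?thesis by simp
        qed
      qed
      also have "\<dots> = F y * (\<Sum>j\<in>J. W j y)" by (simp add: sum_distrib_left)
      also have "\<dots> \<le> F y * 1" using F(2)[OF y] W(3)[OF y] by (intro mult_left_mono) auto
      finally show ?thesis by simp
    qed
  qed (rule F(1))
  finally show ?thesis .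
qed

context kernel_approximation
begin

lemma f0_prob_densities: "f0 \<in> prob_densities"
  using f0_total f0_pos[THEN less_imp_le] by (simp add: prob_densities_def)

text \<open>
  The pointwise lower bound for \<open>f\<close> bounds \<open>f0 ln (f0 / f)\<close> from above; from below it is at least
  \<open>f0 - f\<close> because \<open>ln t \<le> t - 1\<close>. Both bounds are integrable, so the finite branch of \<open>KL_dens\<close> applies.
\<close>

lemma KL_dens_le:
  assumes f: "f \<in> prob_densities"
    and g: "\<And>x. 0 < g x" "integrable lborel (\<lambda>x. f0 x * ln (f0 x / g x))"
    and fg: "AE x in lborel. exp (- (e * (2 + x\<^sup>2))) * g x \<le> f x"
  shows "KL_dens f0 f
    \<le> ereal ((\<integral>x. f0 x * ln (f0 x / g x) \<partial>lborel) + e * (\<integral>x. f0 x * (2 + x\<^sup>2) \<partial>lborel))"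
proof -
  let ?u = "\<lambda>x. f0 x * ln (f0 x / g x) + e * (f0 x * (2 + x\<^sup>2))"
  have [measurable]: "f \<in> borel_measurable borel" using f by (simp add: prob_densities_def)
  have f_int: "integrable lborel f"
    using f by (intro integrableI_nonneg) (auto simp: prob_densities_def)
  have q_int: "integrable lborel (\<lambda>x. f0 x * (2 + x\<^sup>2))"
    using integrable_f0_quadratic[of 2 1] by simp
  have u_int: "integrable lborel ?u"
    by (intro Bochner_Integration.integrable_add integrable_mult_right g q_int)
  have f_pos: "AE x in lborel. 0 < f x"
    using fg
  proof eventually_elim
    case (elim x)
    have "0 < exp (- (e * (2 + x\<^sup>2))) * g x" using g(1)[of x] by simp
    then show ?case using elim by linarith
  qed
  have upper: "AE x in lborel. f0 x * ln (f0 x / f x) \<le> ?u x"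
    using fg f_pos
  proof eventually_elim
    case (elim x)
    have "ln (exp (- (e * (2 + x\<^sup>2))) * g x) \<le> ln (f x)"
      using elim g(1)[of x] by (intro ln_mono) auto
    then have "ln (f0 x / f x) \<le> ln (f0 x / g x) + e * (2 + x\<^sup>2)"
      using elim g(1)[of x] f0_pos[of x] by (simp add: ln_div ln_mult_pos)
    then have "f0 x * ln (f0 x / f x) \<le> f0 x * (ln (f0 x / g x) + e * (2 + x\<^sup>2))"
      using f0_pos[of x] by (intro mult_left_mono) auto
    then show ?case by (simp add: distrib_left mult.left_commute)
  qed
  have lower: "AE x in lborel. f0 x - f x \<le> f0 x * ln (f0 x / f x)"
    using f_pos
  proof eventually_elim
    case (elim x)
    have "ln (f x / f0 x) \<le> f x / f0 x - 1"
      using elim f0_pos[of x] by (intro ln_le_minus_one) simp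
    then have "f0 x * (1 - f x / f0 x) \<le> f0 x * ln (f0 x / f x)"
      using elim f0_pos[of x] by (intro mult_left_mono) (auto simp: ln_div)
    then show ?case using f0_pos[of x] by (simp add: right_diff_distrib)
  qed
  have kl_int: "integrable lborel (\<lambda>x. f0 x * ln (f0 x / f x))"
  proof (rule Bochner_Integration.integrable_bound)
    show "integrable lborel (\<lambda>x. \<bar>f0 x - f x\<bar> + \<bar>?u x\<bar>)"
      by (rule Bochner_Integration.integrable_add[OF
            integrable_abs[OF Bochner_Integration.integrable_diff[OF f0_integrable f_int]] integrable_abs[OF u_int]])
    have between: "\<bar>a\<bar> \<le> \<bar>l\<bar> + \<bar>u\<bar>" if "l \<le> a" "a \<le> u" for a l u :: real
      using that by linarith
    show "AE x in lborel. norm (f0 x * ln (f0 x / f x)) \<le> norm (\<bar>f0 x - f x\<bar> + \<bar>?u x\<bar>)"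
      using upper lower
    proof eventually_elim
      case (elim x)
      then show ?case using between[OF elim(2,1)] by simp
    qed
  qed measurable
  have "KL_dens f0 f = ereal (\<integral>x. f0 x * ln (f0 x / f x) \<partial>lborel)"
    using f_pos kl_int unfolding KL_dens_def by (auto elim: eventually_mono)
  also have "(\<integral>x. f0 x * ln (f0 x / f x) \<partial>lborel) \<le> (\<integral>x. ?u x \<partial>lborel)"
    by (rule integral_mono_AE[OF kl_int u_int upper])
  also have "(\<integral>x. ?u x \<partial>lborel)
      = (\<integral>x. f0 x * ln (f0 x / g x) \<partial>lborel) + e * (\<integral>x. f0 x * (2 + x\<^sup>2) \<partial>lborel)"
    using g(2) q_int by (subst Bochner_Integration.integral_add) auto
  finally show ?thesis by simp
qed

text \<open>
  The cells are \<open>[s j, s (j + 1))\<close> with \<open>s\<close> a fraction of \<open>m\<close>, so that finitely many of them tile \<open>[-m, m)\<close>;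
  \<open>c\<close> sends a point to the centre of its cell, \<open>w j\<close> is the hat function on cell \<open>j\<close> with value 1 at the
  centre, and \<open>G j\<close> is the contribution of cell \<open>j\<close>. Since \<open>w j \<circ> c\<close> is the indicator of cell \<open>j\<close>, the
  integral of \<open>w j (c \<theta>) * f0 \<theta>\<close> is the \<open>f0\<close>-mass of that cell: the image of \<open>f0\<close> under \<open>c\<close> gives the test
  function \<open>w j\<close> exactly the mass of its cell.
\<close>

lemma discretization:
  assumes h: "0 < h" and e: "0 < e"
  obtains J :: "int set" and w :: "int \<Rightarrow> real \<Rightarrow> real" and c :: "real \<Rightarrow> real"
    and G :: "int \<Rightarrow> real \<Rightarrow> real" and d :: real
  where "finite J" "0 < d" "d < h"
    "\<And>j. continuous_on UNIV (w j)" "\<And>j \<theta>. 0 \<le> w j \<theta>" "\<And>\<theta>. (\<Sum>j\<in>J. w j \<theta>) \<le> 1" "\<And>j \<theta>. w j \<theta> \<le> 1"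
    "c \<in> borel_measurable borel" "\<And>j. 0 < (\<integral>\<theta>. w j (c \<theta>) * f0 \<theta> \<partial>lborel)"
    "\<And>j x. 0 \<le> G j x" "\<And>x. smoothed {- real (Suc n)..<real (Suc n)} h x = (\<Sum>j\<in>J. G j x)"
    "\<And>j \<theta>' \<phi> x. j \<in> J \<Longrightarrow> 0 < w j \<theta>' \<Longrightarrow> \<bar>\<phi> - h\<bar> \<le> d \<Longrightarrow>
      exp (- (e * (1 + x\<^sup>2))) * G j x \<le> (\<integral>\<theta>. w j (c \<theta>) * f0 \<theta> \<partial>lborel) * K \<theta>' \<phi> x"
proof -
  let ?m = "real (Suc n)"
  obtain d where d: "0 < d" "d < h"
    and near: "\<And>\<theta> \<theta>' \<phi> x. \<bar>\<theta>\<bar> \<le> ?m \<Longrightarrow> \<bar>\<theta>' - \<theta>\<bar> \<le> d \<Longrightarrow> \<bar>\<phi> - h\<bar> \<le> d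
      \<Longrightarrow> exp (- (e * (1 + x\<^sup>2))) * K \<theta> h x \<le> K \<theta>' \<phi> x"
    using K_nearby[OF h _ e, of ?m] by auto
  obtain N where N: "?m / d < real N" using reals_Archimedean2 by blast
  have N0: "0 < real N" by (rule le_less_trans[OF _ N]) (use d in simp)
  define s where "s = ?m / real N"
  have s: "0 < s" "s < d" "s * real N = ?m"
    using N N0 d by (auto simp: s_def field_simps)
  define cell where "cell j = {s * of_int j..<s * (of_int j + 1)}" for j :: int
  define mid where "mid j = s * (of_int j + 1/2)" for j :: int
  define c where "c \<theta> = mid \<lfloor>\<theta> / s\<rfloor>" for \<theta>
  define w where "w j \<theta> = max 0 (1 - \<bar>\<theta> - mid j\<bar> / (s / 2))" for j \<theta>
  define J where "J = {- int N..<int N}"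
  have cell_iff: "\<theta> \<in> cell j \<longleftrightarrow> \<lfloor>\<theta> / s\<rfloor> = j" for \<theta> j
    using s by (auto simp: cell_def floor_eq_iff field_simps)
  have cell_sets [measurable]: "cell j \<in> sets borel" for j by (simp add: cell_def)
  have w_supp: "\<theta> \<in> cell j" if "0 < w j \<theta>" for j \<theta>
  proof -
    have "\<bar>\<theta> - mid j\<bar> / (s / 2) < 1" using that by (simp add: w_def less_max_iff_disj)
    then have "\<bar>\<theta> - mid j\<bar> < s / 2" using s(1) by (subst (asm) pos_divide_less_eq) auto
    moreover have "mid j = s * of_int j + s / 2" by (simp add: mid_def distrib_left)
    ultimately have "s * of_int j \<le> \<theta>" "\<theta> < s * of_int j + s" by linarith+
    then show ?thesis by (simp add: cell_def distrib_left)
  qed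
  have mid_floor: "\<lfloor>mid j / s\<rfloor> = j" for j
    using s by (simp add: mid_def floor_eq_iff)
  have w_nonneg: "0 \<le> w j \<theta>" for j \<theta> by (simp add: w_def)
  have w_le: "w j \<theta> \<le> indicator (cell j) \<theta>" for j \<theta>
  proof (cases "0 < w j \<theta>")
    case True
    then show ?thesis using w_supp[OF True] s by (simp add: w_def)
  next
    case False
    then have "w j \<theta> = 0" using w_nonneg[of j \<theta>] by simp
    then show ?thesis by simp
  qed
  have wc: "w j (c \<theta>) = indicator (cell j) \<theta>" for j \<theta>
  proof (cases "\<theta> \<in> cell j")
    case True
    then have "c \<theta> = mid j" by (simp add: c_def cell_iff)
    then show ?thesis using True by (simp add: w_def)
  next
    case False
    then have "c \<theta> \<notin> cell j" by (simp add: c_def cell_iff mid_floor)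
    then have "w j (c \<theta>) \<le> 0" using w_le[of j "c \<theta>"] by simp
    then show ?thesis using False w_nonneg[of j "c \<theta>"] by simp
  qed
  have in_J: "\<lfloor>\<theta> / s\<rfloor> \<in> J \<longleftrightarrow> \<theta> \<in> {- ?m..<?m}" for \<theta>
  proof -
    have "\<lfloor>\<theta> / s\<rfloor> \<in> J \<longleftrightarrow> - real N \<le> \<theta> / s \<and> \<theta> / s < real N"
      by (simp add: J_def le_floor_iff floor_less_iff)
    also have "\<dots> \<longleftrightarrow> - (s * real N) \<le> \<theta> \<and> \<theta> < s * real N"
      using s(1) by (simp add: pos_le_divide_eq pos_divide_less_eq mult.commute)
    finally show ?thesis by (simp add: s(3))
  qed
  have ind_sum: "(\<Sum>j\<in>J. indicator (cell j) \<theta>) = (indicator {- ?m..<?m} \<theta> :: real)" for \<theta>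
  proof -
    have "(\<Sum>j\<in>J. indicator (cell j) \<theta>) = (\<Sum>j\<in>J. if j = \<lfloor>\<theta> / s\<rfloor> then 1 else (0::real))"
      by (intro sum.cong) (auto simp: indicator_def cell_iff)
    also have "\<dots> = (if \<lfloor>\<theta> / s\<rfloor> \<in> J then 1 else 0)" by (simp add: J_def)
    finally show ?thesis by (simp add: in_J indicator_def)
  qed
  have mass: "(\<integral>\<theta>. w j (c \<theta>) * f0 \<theta> \<partial>lborel) = (\<integral>\<theta>. indicator (cell j) \<theta> * f0 \<theta> \<partial>lborel)" for j
    by (simp add: wc)
  have cell_int: "integrable lborel (\<lambda>\<theta>. indicator (cell j) \<theta> * f0 \<theta>)" for j
    using integrable_mult_indicator[OF _ f0_integrable, of "cell j"] by (simp add: cell_def)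
  show ?thesis
  proof (rule that[of J d w c "\<lambda>j. smoothed (cell j) h"])
    show "finite J" by (simp add: J_def)
    show "0 < d" "d < h" by (rule d)+
    show "continuous_on UNIV (w j)" for j
      unfolding w_def by (intro continuous_intros) (use s in auto)
    show "0 \<le> w j \<theta>" for j \<theta> by (rule w_nonneg)
    show "w j \<theta> \<le> 1" for j \<theta> by (rule order_trans[OF w_le]) (simp add: indicator_def)
    show "(\<Sum>j\<in>J. w j \<theta>) \<le> 1" for \<theta>
    proof -
      have "(\<Sum>j\<in>J. w j \<theta>) \<le> (\<Sum>j\<in>J. indicator (cell j) \<theta>)" by (intro sum_mono w_le)
      also have "\<dots> \<le> 1" unfolding ind_sum by (simp add: indicator_def)
      finally show ?thesis .
    qed
    show "c \<in> borel_measurable borel"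
      unfolding c_def mid_def by measurable
    show "0 < (\<integral>\<theta>. w j (c \<theta>) * f0 \<theta> \<partial>lborel)" for j
      unfolding mass cell_def by (rule integral_Ico_pos[OF f0_integrable f0_pos]) (use s in simp)
    show "0 \<le> smoothed (cell j) h x" for j x
      unfolding smoothed_def using f0_pos K_pos[OF h]
      by (intro Bochner_Integration.integral_nonneg mult_nonneg_nonneg) (auto intro: less_imp_le)
    show "smoothed {- ?m..<?m} h x = (\<Sum>j\<in>J. smoothed (cell j) h x)" for x
      unfolding smoothed_def
      by (subst Bochner_Integration.integral_sum[symmetric])
        (auto intro!: integrable_smoothed[OF h] simp: sum_distrib_right[symmetric] ind_sum)
    show "exp (- (e * (1 + x\<^sup>2))) * smoothed (cell j) h x
        \<le> (\<integral>\<theta>. w j (c \<theta>) * f0 \<theta> \<partial>lborel) * K \<theta>' \<phi> x"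
      if j: "j \<in> J" and w: "0 < w j \<theta>'" and \<phi>: "\<bar>\<phi> - h\<bar> \<le> d" for j \<theta>' \<phi> x
    proof -
      let ?E = "exp (- (e * (1 + x\<^sup>2)))"
      have "?E * smoothed (cell j) h x = (\<integral>\<theta>. ?E * (indicator (cell j) \<theta> * f0 \<theta> * K \<theta> h x) \<partial>lborel)"
        by (simp add: smoothed_def)
      also have "\<dots> \<le> (\<integral>\<theta>. indicator (cell j) \<theta> * f0 \<theta> * K \<theta>' \<phi> x \<partial>lborel)"
      proof (intro integral_mono integrable_mult_right integrable_mult_left integrable_smoothed h cell_int)
        fix \<theta>
        show "?E * (indicator (cell j) \<theta> * f0 \<theta> * K \<theta> h x) \<le> indicator (cell j) \<theta> * f0 \<theta> * K \<theta>' \<phi> x"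
        proof (cases "\<theta> \<in> cell j")
          case True
          then have "\<theta> \<in> {- ?m..<?m}" using in_J[of \<theta>] j by (simp add: cell_iff)
          then have "\<bar>\<theta>\<bar> \<le> ?m" by auto
          moreover have "\<bar>\<theta>' - \<theta>\<bar> \<le> d"
            using True w_supp[OF w] s(2) by (auto simp: cell_def distrib_left abs_le_iff)
          ultimately have "?E * K \<theta> h x \<le> K \<theta>' \<phi> x" using near \<phi> by blast
          then have "f0 \<theta> * (?E * K \<theta> h x) \<le> f0 \<theta> * K \<theta>' \<phi> x"
            using f0_pos[of \<theta>] by (intro mult_left_mono) auto
          then show ?thesis using True by (simp add: mult.left_commute)
        qed simp
      qed simp
      also have "\<dots> = (\<integral>\<theta>. w j (c \<theta>) * f0 \<theta> \<partial>lborel) * K \<theta>' \<phi> x"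
        unfolding mass by simp
      finally show ?thesis .
    qed
  qed
qed

text \<open>
  A form of the lower bound that fits both types of mixture. For Type I the scale is mixed as well, and
  \<open>V\<close> is a hat function around \<open>h\<close> in the scale; for Type II the scale is a constant near \<open>h\<close> and
  \<open>V = 1\<close>. The threshold \<open>b j\<close> is slightly smaller than the mass of cell \<open>j\<close>, so the condition is open.
\<close>

lemma kl_test_functions:
  assumes \<epsilon>: "0 < \<epsilon>"
  obtains J :: "int set" and w :: "int \<Rightarrow> real \<Rightarrow> real" and c :: "real \<Rightarrow> real"
    and b :: "int \<Rightarrow> real" and h d :: real
  where "finite J" "0 < d" "d < h"
    "\<And>j. continuous_on UNIV (w j)" "\<And>j \<theta>. 0 \<le> w j \<theta>" "\<And>j \<theta>. w j \<theta> \<le> 1"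
    "c \<in> borel_measurable borel" "\<And>j. b j < (\<integral>\<theta>. w j (c \<theta>) * f0 \<theta> \<partial>lborel)"
    "\<And>(P :: 'a measure) t p V. prob_space P \<Longrightarrow> t \<in> borel_measurable P \<Longrightarrow> p \<in> borel_measurable P \<Longrightarrow>
      V \<in> borel_measurable P \<Longrightarrow>
      (\<And>y. y \<in> space P \<Longrightarrow> 0 < p y \<and> 0 \<le> V y \<and> V y \<le> 1 \<and> (0 < V y \<longrightarrow> \<bar>p y - h\<bar> \<le> d)) \<Longrightarrow>
      (\<And>j. j \<in> J \<Longrightarrow> b j < (\<integral>y. w j (t y) * V y \<partial>P)) \<Longrightarrow>
      KL_dens f0 (\<lambda>x. \<integral>y. K (t y) (p y) x \<partial>P) < ereal \<epsilon>"
proof -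
  obtain h n where h: "0 < h"
    and g_int: "integrable lborel (\<lambda>x. f0 x * ln (f0 x / smoothed {- real (Suc n)..<real (Suc n)} h x))"
    and g_small: "(\<integral>x. f0 x * ln (f0 x / smoothed {- real (Suc n)..<real (Suc n)} h x) \<partial>lborel) < \<epsilon> / 2"
    and g_pos: "\<And>x. 0 < smoothed {- real (Suc n)..<real (Suc n)} h x"
    using truncated_kl_small[of "\<epsilon> / 2"] \<epsilon> by auto
  let ?g = "smoothed {- real (Suc n)..<real (Suc n)} h"
  define B where "B = (\<integral>x. f0 x * (2 + x\<^sup>2) \<partial>lborel)"
  have B: "0 \<le> B" unfolding B_def
    using f0_pos by (intro Bochner_Integration.integral_nonneg mult_nonneg_nonneg) (auto intro: less_imp_le)
  \<comment> \<open>The loss \<open>e B\<close> then uses up the second half of \<open>\<epsilon>\<close>.\<close>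
  define e where "e = \<epsilon> / 2 / (B + 1)"
  have e: "0 < e" using \<epsilon> B by (simp add: e_def)
  have "e * B \<le> e * (B + 1)" using e by simp
  also have "\<dots> = \<epsilon> / 2" using B by (simp add: e_def field_simps)
  finally have eB: "e * B \<le> \<epsilon> / 2" .
  obtain J :: "int set" and w c G d where D: "finite J" "0 < d" "d < h"
    "\<And>j. continuous_on UNIV (w j)" "\<And>j \<theta>. 0 \<le> w j \<theta>" "\<And>\<theta>. (\<Sum>j\<in>J. w j \<theta>) \<le> 1" "\<And>j \<theta>. w j \<theta> \<le> 1"
    "c \<in> borel_measurable borel" "\<And>j. 0 < (\<integral>\<theta>. w j (c \<theta>) * f0 \<theta> \<partial>lborel)"
    "\<And>j x. 0 \<le> G j x" "\<And>x. ?g x = (\<Sum>j\<in>J. G j x)"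
    "\<And>j \<theta>' \<phi> x. j \<in> J \<Longrightarrow> 0 < w j \<theta>' \<Longrightarrow> \<bar>\<phi> - h\<bar> \<le> d \<Longrightarrow>
      exp (- (e * (1 + x\<^sup>2))) * G j x \<le> (\<integral>\<theta>. w j (c \<theta>) * f0 \<theta> \<partial>lborel) * K \<theta>' \<phi> x"
    by (rule discretization[OF h e, of n]) blast
  define m where "m j = (\<integral>\<theta>. w j (c \<theta>) * f0 \<theta> \<partial>lborel)" for j
  show ?thesis
  proof (rule that[of J d h w c "\<lambda>j. exp (- e) * m j"])
    show "exp (- e) * m j < (\<integral>\<theta>. w j (c \<theta>) * f0 \<theta> \<partial>lborel)" for j
      using D(9)[of j] e by (simp add: m_def)
    fix P :: "'a measure" and t p V
    assume P: "prob_space P" and [measurable]: "t \<in> borel_measurable P" "p \<in> borel_measurable P" "V \<in> borel_measurable P"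
      and V: "\<And>y. y \<in> space P \<Longrightarrow> 0 < p y \<and> 0 \<le> V y \<and> V y \<le> 1 \<and> (0 < V y \<longrightarrow> \<bar>p y - h\<bar> \<le> d)"
      and near: "\<And>j. j \<in> J \<Longrightarrow> exp (- e) * m j < (\<integral>y. w j (t y) * V y \<partial>P)"
    let ?f = "\<lambda>x. \<integral>y. K (t y) (p y) x \<partial>P"
    have [measurable]: "w j \<in> borel_measurable borel" for j
      by (rule borel_measurable_continuous_onI[OF D(4)])
    have wV: "w j (t y) * V y \<le> w j (t y)" if "y \<in> space P" for j y
      using mult_left_mono[of "V y" 1 "w j (t y)"] V[OF that] D(5)[of j "t y"] by simp
    have low: "exp (- (e * (2 + x\<^sup>2))) * ?g x \<le> ?f x"
      if int: "integrable P (\<lambda>y. K (t y) (p y) x)" for x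
    proof -
      let ?E = "exp (- (e * (1 + x\<^sup>2)))"
      have "exp (- e) * (\<Sum>j\<in>J. ?E * G j x) \<le> ?f x"
      proof (rule weighted_lower_bound[OF P int _ D(1), where W = "\<lambda>j y. w j (t y) * V y" and b = m])
        show "0 \<le> K (t y) (p y) x" if "y \<in> space P" for y
          using V[OF that] by (intro less_imp_le K_pos) simp
        show "0 \<le> w j (t y) * V y" if "y \<in> space P" for j y
          using V[OF that] D(5) by simp
        show "(\<Sum>j\<in>J. w j (t y) * V y) \<le> 1" if "y \<in> space P" for y
          by (rule order_trans[OF sum_mono[OF wV[OF that]] D(6)])
        show "0 \<le> ?E * G j x" for j using D(10) by simp
        show "0 < m j" for j unfolding m_def by (rule D(9))
        show "?E * G j x \<le> m j * K (t y) (p y) x"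
          if "j \<in> J" "y \<in> space P" "0 < w j (t y) * V y" for j y
        proof -
          have "0 < w j (t y)" "0 < V y"
            using that(3) D(5)[of j "t y"] V[OF that(2)] by (auto simp: zero_less_mult_iff)
          then show ?thesis unfolding m_def using D(12)[OF that(1)] V[OF that(2)] by blast
        qed
        show "exp (- e) * m j \<le> (\<integral>y. w j (t y) * V y \<partial>P)" if "j \<in> J" for j
          using near[OF that] by simp
      qed measurable
      moreover have "exp (- e) * (\<Sum>j\<in>J. ?E * G j x) = (exp (- e) * ?E) * ?g x"
        by (simp only: D(11) sum_distrib_left mult.assoc)
      moreover have "exp (- e) * ?E = exp (- (e * (2 + x\<^sup>2)))"
        by (simp add: algebra_simps flip: exp_add)
      ultimately show ?thesis by simp
    qed
    have pos: "0 < p y" if "y \<in> space P" for y using V[OF that] by simp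
    have "AE x in lborel. integrable P (\<lambda>y. K (t y) (p y) x)"
      by (rule mixture_density(1)[OF P _ _ pos]) measurable
    then have "AE x in lborel. exp (- (e * (2 + x\<^sup>2))) * ?g x \<le> ?f x"
      by eventually_elim (rule low)
    then have "KL_dens f0 ?f \<le> ereal ((\<integral>x. f0 x * ln (f0 x / ?g x) \<partial>lborel) + e * B)"
      unfolding B_def using mixture_density(2)[of P t p] P pos
      by (intro KL_dens_le g_int g_pos) auto
    also have "\<dots> < ereal \<epsilon>" using g_small eB by simp
    finally show "KL_dens f0 ?f < ereal \<epsilon>" .
  qed (fact D)+
qed

end

section \<open>Priors with full weak support\<close>

context log_quadratic_kernel
begin

text \<open>
  The integrand is nonnegative, so the Bochner integral is the nonnegative integral with \<open>\<infinity>\<close> replaced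
  by 0, also where it diverges; measurability of the latter in the measure is a property of the Giry
  monad.
\<close>

lemma mixture_joint_measurable:
  assumes L: "L \<in> M \<rightarrow>\<^sub>M subprob_algebra N"
    and t: "t \<in> borel_measurable N"
    and p: "(\<lambda>(\<omega>, y). p \<omega> y) \<in> borel_measurable (M \<Otimes>\<^sub>M N)"
    and pos: "\<And>\<omega> y. \<omega> \<in> space M \<Longrightarrow> y \<in> space N \<Longrightarrow> 0 < p \<omega> y"
  shows "(\<lambda>(\<omega>, x). \<integral>y. K (t y) (p \<omega> y) x \<partial>L \<omega>) \<in> borel_measurable (M \<Otimes>\<^sub>M lborel)"
proof -
  let ?k = "\<lambda>z y. ennreal (K (t y) (p (fst z) y) (snd z))"
  have "(\<lambda>z. \<integral>y. K (t y) (p (fst z) y) (snd z) \<partial>L (fst z)) \<in> borel_measurable (M \<Otimes>\<^sub>M lborel)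
    \<longleftrightarrow> (\<lambda>z. enn2real (\<integral>\<^sup>+y. ?k z y \<partial>L (fst z))) \<in> borel_measurable (M \<Otimes>\<^sub>M lborel)"
  proof (rule measurable_cong)
    fix z :: "'a \<times> real" assume z: "z \<in> space (M \<Otimes>\<^sub>M lborel)"
    then have \<omega>: "fst z \<in> space M" by (auto simp: space_pair_measure)
    have sets_L [measurable_cong]: "sets (L (fst z)) = sets N" by (rule sets_kernel[OF L \<omega>])
    have [measurable]: "t \<in> borel_measurable (L (fst z))"
      using t by (simp cong: measurable_cong_sets add: sets_L)
    have [measurable]: "p (fst z) \<in> borel_measurable (L (fst z))"
      using measurable_Pair2[OF p \<omega>] by (simp cong: measurable_cong_sets add: sets_L)
    have "0 \<le> K (t y) (p (fst z) y) (snd z)" if "y \<in> space (L (fst z))" for y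
      using that by (intro less_imp_le K_pos pos \<omega>) (simp add: sets_eq_imp_space_eq[OF sets_L])
    then show "(\<integral>y. K (t y) (p (fst z) y) (snd z) \<partial>L (fst z)) = enn2real (\<integral>\<^sup>+y. ?k z y \<partial>L (fst z))"
      by (intro integral_eq_nn_integral AE_I2) measurable
  qed
  moreover have "(\<lambda>z. \<integral>\<^sup>+y. ?k z y \<partial>L (fst z)) \<in> borel_measurable (M \<Otimes>\<^sub>M lborel)"
  proof (rule nn_integral_measurable_subprob_algebra2[where N = N])
    have [measurable]: "(\<lambda>q. p (fst (fst q)) (snd q)) \<in> borel_measurable ((M \<Otimes>\<^sub>M (lborel :: real measure)) \<Otimes>\<^sub>M N)"
      using measurable_compose[OF _ p, of "\<lambda>q. (fst (fst q), snd q)" "(M \<Otimes>\<^sub>M (lborel :: real measure)) \<Otimes>\<^sub>M N"]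
      by simp
    have [measurable]: "(\<lambda>q. t (snd q)) \<in> borel_measurable ((M \<Otimes>\<^sub>M (lborel :: real measure)) \<Otimes>\<^sub>M N)"
      by (rule measurable_compose[OF measurable_snd t])
    show "(\<lambda>(z, y). ?k z y) \<in> borel_measurable ((M \<Otimes>\<^sub>M lborel) \<Otimes>\<^sub>M N)"
      unfolding case_prod_beta by measurable
    show "(\<lambda>z. L (fst z)) \<in> M \<Otimes>\<^sub>M lborel \<rightarrow>\<^sub>M subprob_algebra N"
      by (rule measurable_compose[OF measurable_fst L])
  qed
  ultimately show ?thesis by (simp add: case_prod_beta')
qed

end

lemma prior_into_subprob_algebra:
  assumes "Q \<in> space (prob_algebra (prob_measures S))"
  shows "(\<lambda>P. P) \<in> Q \<rightarrow>\<^sub>M subprob_algebra (restrict_space borel S)"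
proof (rule measurable_prob_algebraD)
  have "sets Q = sets (prob_algebra (restrict_space borel S))"
    using assms by (simp add: space_prob_algebra prob_measures_def)
  then show "(\<lambda>P. P) \<in> Q \<rightarrow>\<^sub>M prob_algebra (restrict_space borel S)"
    by (simp cong: measurable_cong_sets)
qed

lemma space_prior:
  assumes "Q \<in> space (prob_algebra (prob_measures S))"
  shows "space Q = space (prob_measures S)"
  using assms by (intro sets_eq_imp_space_eq) (simp add: space_prob_algebra)

context kernel_approximation
begin

lemma pushforward_in_prob_measures:
  assumes "c \<in> borel \<rightarrow>\<^sub>M restrict_space borel S"
  shows "distr (density lborel f0) (restrict_space borel S) c \<in> space (prob_measures S)"
proof -
  have "prob_space (density lborel f0)"
    by (rule prob_spaceI) (simp add: emeasure_density f0_total)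
  then show ?thesis
    using assms by (auto simp: space_prob_measures intro!: prob_space.prob_space_distr)
qed

lemma integral_pushforward:
  fixes g :: "'a::topological_space \<Rightarrow> real"
  assumes c: "c \<in> borel \<rightarrow>\<^sub>M restrict_space borel S" and g: "continuous_on S g"
  shows "(\<integral>y. g y \<partial>distr (density lborel f0) (restrict_space borel S) c) = (\<integral>\<theta>. g (c \<theta>) * f0 \<theta> \<partial>lborel)"
proof -
  have g': "g \<in> borel_measurable (restrict_space borel S)"
    by (rule borel_measurable_continuous_on_restrict[OF g])
  have "(\<lambda>\<theta>. g (c \<theta>)) \<in> borel_measurable borel" by (rule measurable_compose[OF c g'])
  then show ?thesis
    using c g' f0_pos[THEN less_imp_le]
    by (subst integral_distr) (auto simp: integral_density mult.commute)
qed

text \<open>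
  The neighbourhood is centred at the image of \<open>f0\<close> under \<open>\<theta> \<mapsto> (c \<theta>, h)\<close>.
\<close>

lemma type_I_KL_support:
  assumes Q: "Q \<in> space (prob_algebra (prob_measures (UNIV \<times> {0<..})))"
    and full: "measure_support (weak_topology (UNIV \<times> {0<..})) Q = space (prob_measures (UNIV \<times> {0<..}))"
  shows "f0 \<in> KL_support (type_I_prior k Q)"
  unfolding KL_support_def
proof (intro CollectI conjI allI impI f0_prob_densities)
  fix \<epsilon> :: real assume \<epsilon>: "0 < \<epsilon>"
  let ?S = "UNIV \<times> {0<..} :: (real \<times> real) set"
  let ?N = "restrict_space borel ?S :: (real \<times> real) measure"
  obtain J :: "int set" and w c b h d where T: "finite J" "0 < d" "d < h"
    "\<And>j. continuous_on UNIV (w j)" "\<And>j \<theta>. 0 \<le> w j \<theta>" "\<And>j \<theta>. w j \<theta> \<le> 1"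
    "c \<in> borel_measurable borel" "\<And>j. b j < (\<integral>\<theta>. w j (c \<theta>) * f0 \<theta> \<partial>lborel)"
    and KL: "\<And>(P :: (real \<times> real) measure) t p V. prob_space P \<Longrightarrow> t \<in> borel_measurable P \<Longrightarrow> p \<in> borel_measurable P \<Longrightarrow>
      V \<in> borel_measurable P \<Longrightarrow>
      (\<And>y. y \<in> space P \<Longrightarrow> 0 < p y \<and> 0 \<le> V y \<and> V y \<le> 1 \<and> (0 < V y \<longrightarrow> \<bar>p y - h\<bar> \<le> d)) \<Longrightarrow>
      (\<And>j. j \<in> J \<Longrightarrow> b j < (\<integral>y. w j (t y) * V y \<partial>P)) \<Longrightarrow>
      KL_dens f0 (\<lambda>x. \<integral>y. K (t y) (p y) x \<partial>P) < ereal \<epsilon>"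
    by (rule kl_test_functions[OF \<epsilon>]) blast
  define V where "V y = max 0 (1 - \<bar>snd y - h\<bar> / d)" for y :: "real \<times> real"
  have V_cont: "continuous_on A V" for A
    unfolding V_def by (intro continuous_intros) (use T in auto)
  have V: "0 \<le> V y" "V y \<le> 1" "0 < V y \<Longrightarrow> \<bar>snd y - h\<bar> \<le> d" for y
    using T(2) by (auto simp: V_def less_max_iff_disj)
  have mix: "mixture_I k P = (\<lambda>x. \<integral>y. K (fst y) (snd y) x \<partial>P)" for P
    by (rule ext) (simp add: mixture_I_def case_prod_beta')
  have fst_N: "fst \<in> borel_measurable ?N" and snd_N: "snd \<in> borel_measurable ?N" and V_N: "V \<in> borel_measurable ?N"
    by (intro borel_measurable_continuous_on_restrict continuous_intros V_cont)+
  have space_N: "space ?N = ?S" by (simp add: space_restrict_space)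
  have P: "prob_space P" "fst \<in> borel_measurable P" "snd \<in> borel_measurable P" "V \<in> borel_measurable P"
    "\<And>y. y \<in> space P \<Longrightarrow> 0 < snd y"
    if "P \<in> space (prob_measures ?S)" for P
  proof -
    have sets_P: "sets P = sets ?N" and "prob_space P" using that by (auto simp: space_prob_measures)
    then show "prob_space P" "fst \<in> borel_measurable P" "snd \<in> borel_measurable P" "V \<in> borel_measurable P"
      using fst_N snd_N V_N by (simp_all only: measurable_cong_sets[OF sets_P refl])
    have "space P = ?S" by (rule trans[OF sets_eq_imp_space_eq[OF sets_P] space_N])
    then show "0 < snd y" if "y \<in> space P" for y
      using that by (simp add: mem_Times_iff)
  qed
  define g where "g j y = w j (fst y) * V y" for j and y :: "real \<times> real"
  have g_cont: "continuous_on ?S (g j)" for j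
    unfolding g_def
    by (intro continuous_intros V_cont continuous_on_compose2[OF T(4)]) auto
  have g_bdd: "bounded (g j ` ?S)" for j
  proof (rule boundedI)
    fix z assume "z \<in> g j ` ?S"
    then obtain y where "z = w j (fst y) * V y" by (auto simp: g_def)
    then show "norm z \<le> 1"
      using T(5,6)[of j "fst y"] V(1,2)[of y] mult_mono[of "w j (fst y)" 1 "V y" 1] by (simp add: abs_mult)
  qed
  define P0 where "P0 = distr (density lborel f0) ?N (\<lambda>\<theta>. (c \<theta>, h))"
  have c_meas: "(\<lambda>\<theta>. (c \<theta>, h)) \<in> borel \<rightarrow>\<^sub>M ?N"
    using T(2,3,7) by (intro measurable_restrict_space2) (auto simp flip: borel_prod)
  let ?U = "{P \<in> space (prob_measures ?S). \<forall>j\<in>J. b j < (\<integral>y. g j y \<partial>P)}"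
  have "0 < emeasure Q ?U"
  proof (rule full_support_neighbourhood[OF full _ T(1)])
    show "P0 \<in> space (prob_measures ?S)"
      unfolding P0_def by (rule pushforward_in_prob_measures[OF c_meas])
    have "(\<integral>y. g j y \<partial>P0) = (\<integral>\<theta>. w j (c \<theta>) * f0 \<theta> \<partial>lborel)" for j
      unfolding P0_def by (subst integral_pushforward[OF c_meas g_cont]) (simp add: g_def V_def)
    then show "b j < (\<integral>y. g j y \<partial>P0)" for j using T(8) by simp
  qed (rule g_cont g_bdd)+
  then show "0 < emeasure (type_I_prior k Q) {f \<in> space (type_I_prior k Q). KL_dens f0 f < ereal \<epsilon>}"
    unfolding type_I_prior_def
  proof (rule KL_law_positive[OF f0_measurable, rotated 2])
    show "mixture_I k P \<in> prob_densities" if "P \<in> space Q" for P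
      unfolding mix using P[of P] that by (intro mixture_density(2)) (auto simp: space_prior[OF Q])
    show "KL_dens f0 (mixture_I k P) < ereal \<epsilon>" if "P \<in> ?U" for P
      unfolding mix using P[of P] that V by (intro KL[where V = V]) (auto simp: g_def)
    show "(\<lambda>(P, x). mixture_I k P x) \<in> borel_measurable (Q \<Otimes>\<^sub>M lborel)"
      unfolding mix
      by (rule mixture_joint_measurable[OF prior_into_subprob_algebra[OF Q] fst_N])
        (use measurable_compose[OF measurable_snd snd_N] space_N in \<open>auto simp: case_prod_beta'\<close>)
  qed
qed

text \<open>
  The neighbourhood is a rectangle: a weak neighbourhood of the image of \<open>f0\<close> under \<open>c\<close>, times the interval
  of scales within \<open>d\<close> of \<open>h\<close>; independence makes its probability a product of two positive factors.
\<close>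

lemma type_II_KL_support:
  assumes Q: "Q \<in> space (prob_algebra (prob_measures UNIV))"
    and \<mu>: "\<mu> \<in> space (prob_algebra (restrict_space borel {0<..}))"
    and full: "measure_support (weak_topology UNIV) Q = space (prob_measures UNIV)"
    and \<mu>_full: "measure_support (top_of_set {0<..}) \<mu> = {0<..}"
  shows "f0 \<in> KL_support (type_II_prior k Q \<mu>)"
  unfolding KL_support_def
proof (intro CollectI conjI allI impI f0_prob_densities)
  fix \<epsilon> :: real assume \<epsilon>: "0 < \<epsilon>"
  let ?N = "restrict_space borel UNIV :: real measure"
  obtain J :: "int set" and w c b h d where T: "finite J" "0 < d" "d < h"
    "\<And>j. continuous_on UNIV (w j)" "\<And>j \<theta>. 0 \<le> w j \<theta>" "\<And>j \<theta>. w j \<theta> \<le> 1"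
    "c \<in> borel_measurable borel" "\<And>j. b j < (\<integral>\<theta>. w j (c \<theta>) * f0 \<theta> \<partial>lborel)"
    and KL: "\<And>(P :: real measure) t p V. prob_space P \<Longrightarrow> t \<in> borel_measurable P \<Longrightarrow> p \<in> borel_measurable P \<Longrightarrow>
      V \<in> borel_measurable P \<Longrightarrow>
      (\<And>y. y \<in> space P \<Longrightarrow> 0 < p y \<and> 0 \<le> V y \<and> V y \<le> 1 \<and> (0 < V y \<longrightarrow> \<bar>p y - h\<bar> \<le> d)) \<Longrightarrow>
      (\<And>j. j \<in> J \<Longrightarrow> b j < (\<integral>y. w j (t y) * V y \<partial>P)) \<Longrightarrow>
      KL_dens f0 (\<lambda>x. \<integral>y. K (t y) (p y) x \<partial>P) < ereal \<epsilon>"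
    by (rule kl_test_functions[OF \<epsilon>]) blast
  have id_N: "(\<lambda>y. y) \<in> borel_measurable ?N"
    by (intro borel_measurable_continuous_on_restrict continuous_intros)
  have P: "prob_space P" "(\<lambda>y. y) \<in> borel_measurable P"
    if "P \<in> space (prob_measures UNIV)" for P :: "real measure"
    using that id_N by (auto simp: space_prob_measures cong: measurable_cong_sets)
  have w_bdd: "bounded (w j ` UNIV)" for j
    by (rule boundedI[of _ 1]) (use T(5,6) in auto)
  define P0 where "P0 = distr (density lborel f0) ?N c"
  have c_meas: "c \<in> borel \<rightarrow>\<^sub>M ?N"
    using T(7) by (intro measurable_restrict_space2) auto
  let ?U = "{P \<in> space (prob_measures UNIV). \<forall>j\<in>J. b j < (\<integral>y. w j y \<partial>P)}"
  let ?I = "{h - d<..<h + d}"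
  have U: "0 < emeasure Q ?U"
  proof (rule full_support_neighbourhood[OF full _ T(1)])
    show "P0 \<in> space (prob_measures UNIV)"
      unfolding P0_def by (rule pushforward_in_prob_measures[OF c_meas])
    show "b j < (\<integral>y. w j y \<partial>P0)" for j
      unfolding P0_def using T(8) by (subst integral_pushforward[OF c_meas T(4)])
  qed (rule T(4) w_bdd)+
  have I: "0 < emeasure \<mu> ?I"
  proof -
    have "h \<in> measure_support (top_of_set {0<..}) \<mu>" using T(2,3) by (simp add: \<mu>_full)
    moreover have "openin (top_of_set {0<..}) ?I"
      by (rule openin_subset_topspace_eq[THEN iffD2] | rule open_openin_trans) (use T(2,3) in auto)
    ultimately show ?thesis using T(2) by (simp add: measure_support_def)
  qed
  have in_sets: "A \<in> sets M" if "0 < emeasure M A" for A and M :: "'b measure"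
    using that emeasure_notin_sets[of A M] by (cases "A \<in> sets M") auto
  interpret mu: prob_space \<mu> using \<mu> by (simp add: space_prob_algebra)
  have sets_mu: "sets \<mu> = sets (restrict_space borel {0<..})" using \<mu> by (simp add: space_prob_algebra)
  have space_mu: "space \<mu> = {0<..}"
    using sets_eq_imp_space_eq[OF sets_mu] by (simp add: space_restrict_space)
  have id_mu: "(\<lambda>\<phi>. \<phi>) \<in> borel_measurable \<mu>"
    using borel_measurable_continuous_on_restrict[of "{0<..}" "\<lambda>\<phi>::real. \<phi>"]
    by (simp add: continuous_on_id cong: measurable_cong_sets[OF sets_mu])
  have mix: "(case \<omega> of (P, \<phi>) \<Rightarrow> mixture_II k P \<phi>) = (\<lambda>x. \<integral>y. K y (snd \<omega>) x \<partial>fst \<omega>)" for \<omega>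
    by (intro ext) (simp add: mixture_II_def case_prod_beta')
  have "0 < emeasure (Q \<Otimes>\<^sub>M \<mu>) (?U \<times> ?I)"
    using U I in_sets[OF U] in_sets[OF I]
    by (subst mu.emeasure_pair_measure_Times) (auto simp: ennreal_zero_less_mult_iff)
  then show "0 < emeasure (type_II_prior k Q \<mu>) {f \<in> space (type_II_prior k Q \<mu>). KL_dens f0 f < ereal \<epsilon>}"
    unfolding type_II_prior_def
  proof (rule KL_law_positive[OF f0_measurable, rotated 2])
    show "(case \<omega> of (P, \<phi>) \<Rightarrow> mixture_II k P \<phi>) \<in> prob_densities" if "\<omega> \<in> space (Q \<Otimes>\<^sub>M \<mu>)" for \<omega>
      unfolding mix using P[of "fst \<omega>"] that
      by (intro mixture_density(2)) (auto simp: space_pair_measure space_prior[OF Q] space_mu)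
    show "KL_dens f0 (case \<omega> of (P, \<phi>) \<Rightarrow> mixture_II k P \<phi>) < ereal \<epsilon>" if "\<omega> \<in> ?U \<times> ?I" for \<omega>
      unfolding mix using P[of "fst \<omega>"] that T(2,3)
      by (intro KL[where V = "\<lambda>_. 1"]) (auto simp: abs_le_iff)
    show "(\<lambda>(\<omega>, x). (case \<omega> of (P, \<phi>) \<Rightarrow> mixture_II k P \<phi>) x) \<in> borel_measurable ((Q \<Otimes>\<^sub>M \<mu>) \<Otimes>\<^sub>M lborel)"
      unfolding mix
    proof (rule mixture_joint_measurable[where N = ?N])
      show "fst \<in> Q \<Otimes>\<^sub>M \<mu> \<rightarrow>\<^sub>M subprob_algebra ?N"
        by (rule measurable_compose[OF measurable_fst prior_into_subprob_algebra[OF Q]])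
      show "(\<lambda>y. y) \<in> borel_measurable ?N" by (rule id_N)
      show "(\<lambda>(\<omega>, y). snd \<omega>) \<in> borel_measurable ((Q \<Otimes>\<^sub>M \<mu>) \<Otimes>\<^sub>M ?N)"
        using measurable_compose[OF measurable_fst measurable_compose[OF measurable_snd id_mu]]
        by (simp add: case_prod_beta')
    qed (auto simp: space_pair_measure space_mu)
  qed
qed

end

theorem theorem4:
  fixes l :: real and f0 :: "real \<Rightarrow> real" and PiStar :: "(real \<Rightarrow> real) measure"
  assumes prior:
    "(\<exists>Q \<in> space (prob_algebra (prob_measures (UNIV \<times> {0<..}))).
        measure_support (weak_topology (UNIV \<times> {0<..})) Q = space (prob_measures (UNIV \<times> {0<..})) \<and>
        PiStar = type_I_prior (skew_normal l) Q)
     \<or> (\<exists>Q \<in> space (prob_algebra (prob_measures UNIV)).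
        \<exists>\<mu> \<in> space (prob_algebra (restrict_space borel {0<..})).
        measure_support (weak_topology UNIV) Q = space (prob_measures UNIV) \<and>
        measure_support (top_of_set {0<..}) \<mu> = {0<..} \<and>
        PiStar = type_II_prior (skew_normal l) Q \<mu>)"
  and dens: "f0 \<in> prob_densities" "continuous_on UNIV f0"
  and B4: "\<exists>M>0. \<forall>x. 0 < f0 x \<and> f0 x \<le> M"
  and B5: "integrable lborel (\<lambda>x. f0 x * ln (f0 x))"
  and B6: "\<exists>\<delta>>0. integrable lborel (\<lambda>x. f0 x * ln (f0 x / (INF t\<in>{t. \<bar>t - x\<bar> < \<delta>}. f0 t)))"
  and moment: "\<exists>\<eta>>0. integrable lborel (\<lambda>x. \<bar>x\<bar> powr (2 * (1 + \<eta>)) * f0 x)"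
  shows "f0 \<in> KL_support PiStar"
proof -
  obtain M where M: "\<And>x. 0 < f0 x" "\<And>x. f0 x \<le> M" using B4 by blast
  obtain \<delta> where \<delta>: "0 < \<delta>"
    "integrable lborel (\<lambda>x. f0 x * ln (f0 x / (INF t\<in>{t. \<bar>t - x\<bar> < \<delta>}. f0 t)))"
    using B6 by blast
  obtain \<eta> where \<eta>: "0 < \<eta>" "integrable lborel (\<lambda>x. \<bar>x\<bar> powr (2 * (1 + \<eta>)) * f0 x)"
    using moment by blast
  have [measurable]: "f0 \<in> borel_measurable borel" using dens(1) by (simp add: prob_densities_def)
  have total: "(\<integral>\<^sup>+x. ennreal (f0 x) \<partial>lborel) = 1" using dens(1) by (simp add: prob_densities_def)
  have int: "integrable lborel f0"
    using total M(1)[THEN less_imp_le] by (intro integrableI_nonneg) auto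
  have "integrable lborel (\<lambda>x. x\<^sup>2 * f0 x)"
  proof (rule Bochner_Integration.integrable_bound)
    show "integrable lborel (\<lambda>x. f0 x + \<bar>x\<bar> powr (2 * (1 + \<eta>)) * f0 x)"
      by (intro Bochner_Integration.integrable_add int \<eta>(2))
    have "norm (x\<^sup>2 * f0 x) \<le> norm (f0 x + \<bar>x\<bar> powr (2 * (1 + \<eta>)) * f0 x)" for x
    proof -
      \<comment> \<open>The summand 1 covers \<open>\<bar>x\<bar> \<le> 1\<close>, where the higher power is the smaller one.\<close>
      have "x\<^sup>2 \<le> 1 + \<bar>x\<bar> powr (2 * (1 + \<eta>))"
      proof (cases "\<bar>x\<bar> \<le> 1")
        case True
        then have "x\<^sup>2 \<le> 1" by (simp add: abs_square_le_1)
        then show ?thesis by (rule order_trans) simp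
      next
        case False
        then have "\<bar>x\<bar> powr 2 \<le> \<bar>x\<bar> powr (2 * (1 + \<eta>))" using \<eta>(1) by (intro powr_mono) auto
        then show ?thesis using False by (simp add: powr_numeral)
      qed
      then have "x\<^sup>2 * f0 x \<le> (1 + \<bar>x\<bar> powr (2 * (1 + \<eta>))) * f0 x"
        using M(1)[of x] by (intro mult_right_mono) auto
      then show ?thesis using M(1)[of x] by (simp add: distrib_right abs_mult)
    qed
    then show "AE x in lborel. norm (x\<^sup>2 * f0 x) \<le> norm (f0 x + \<bar>x\<bar> powr (2 * (1 + \<eta>)) * f0 x)"
      by (intro AE_I2)
  qed measurable
  then interpret kernel_approximation "skew_normal l" "1 + exp (3/2) * \<bar>l\<bar> * (1 + \<bar>l\<bar>)" f0 M \<delta>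
    using dens(2) total M \<delta> B5
    by unfold_locales (simp_all add: skew_normal_pos skew_normal_total ln_skew_normal_bound)
  from prior show ?thesis
    by (elim disjE bexE conjE) (simp_all only: type_I_KL_support type_II_KL_support)
qed

end
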